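(* Let $\mathcal A$ be a unital $C^*$-algebra with a faithful finite trace. Let $u\in U_{\mathcal A}$ and let $\beta:[0,1]\to U_{\mathcal A}$ be a geodesic such that $d_\infty(u,\beta(s))<\frac{\pi}{2}$ for all $s\in[0,1]$. Then $g(s)=d_\infty(u,\beta(s))$, $s\in[0,1]$, is a convex function.
   Context: $U_{\mathcal A}$ is the unitary group of $\mathcal A$, with the norm topology. A curve is smooth if it is $C^1$ (for the norm of $\mathcal A$) with non-vanishing derivative. The length of a piecewise smooth curve $\gamma:[a,b]\to U_{\mathcal A}$ is $\int_a^b\|\dot\gamma(t)\|\,dt$, with $\|\cdot\|$ the norm of $\mathcal A$, and $d_\infty(u,v)$ is the infimum of the lengths of the piecewise smooth curves in $U_{\mathcal A}$ joining $u$ to $v$ (the hypothesis includes that such curves exist). A geodesic of $U_{\mathcal A}$ is a curve of the form $\beta(s)=we^{sz}$ with $w\in U_{\mathcal A}$ and $z\in\mathcal A$, $z^*=-z$. A faithful finite trace is a positive linear functional $\tau$ on $\mathcal A$ with $\tau(xy)=\tau(yx)$ for all $x,y$, and $\tau(x^*x)=0$ only if $x=0$. *)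

theory Defs
  imports "HOL-Analysis.Analysis"
begin

text \<open>
  Unital complex C*-algebras. The type class \<^class>\<open>real_normed_algebra_1\<close> contributes the real
  Banach algebra structure. It also imposes \<open>norm 1 = 1\<close>, which in a C*-algebra is automatic
  unless the algebra is \<open>{0}\<close>.
\<close>

class unital_cstar_algebra = real_normed_algebra_1 + banach +
  fixes scaleC :: "complex \<Rightarrow> 'a \<Rightarrow> 'a"  (infixr "*\<^sub>C" 75)
    and star :: "'a \<Rightarrow> 'a"
  assumes scaleC_add_right: "c *\<^sub>C (x + y) = c *\<^sub>C x + c *\<^sub>C y"
    and scaleC_add_left: "(c + d) *\<^sub>C x = c *\<^sub>C x + d *\<^sub>C x"
    and scaleC_scaleC: "c *\<^sub>C d *\<^sub>C x = (c * d) *\<^sub>C x"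
    and scaleC_of_real: "complex_of_real r *\<^sub>C x = r *\<^sub>R x"
    and mult_scaleC_left: "(c *\<^sub>C x) * y = c *\<^sub>C (x * y)"
    and mult_scaleC_right: "x * (c *\<^sub>C y) = c *\<^sub>C (x * y)"
    and norm_scaleC: "norm (c *\<^sub>C x) = cmod c * norm x"
    and star_star: "star (star x) = x"
    and star_add: "star (x + y) = star x + star y"
    and star_scaleC: "star (c *\<^sub>C x) = cnj c *\<^sub>C star x"
    and star_mult: "star (x * y) = star y * star x"
    and cstar_identity: "norm (star x * x) = (norm x)\<^sup>2"

definition unitary_group :: "'a::unital_cstar_algebra set" where
  "unitary_group = {u. star u * u = 1 \<and> u * star u = 1}"

definition faithful_finite_trace :: "('a::unital_cstar_algebra \<Rightarrow> complex) \<Rightarrow> bool" where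
  "faithful_finite_trace \<tau> \<longleftrightarrow>
     (\<forall>x y. \<tau> (x + y) = \<tau> x + \<tau> y) \<and>
     (\<forall>c x. \<tau> (c *\<^sub>C x) = c * \<tau> x) \<and>
     (\<forall>x. \<tau> (star x * x) \<in> \<real>\<^sub>\<ge>\<^sub>0) \<and>
     (\<forall>x y. \<tau> (x * y) = \<tau> (y * x)) \<and>
     (\<forall>x. \<tau> (star x * x) = 0 \<longrightarrow> x = 0)"

text \<open>
  Derivatives are taken within the closed interval, hence are one-sided at its end points. The
  library's \<open>piecewise_C1_differentiable_on\<close> is not used below: it imposes nothing on the
  derivative near the break points and permits it to vanish.
\<close>

definition smooth_curve_on :: "real \<Rightarrow> real \<Rightarrow> (real \<Rightarrow> 'a::real_normed_vector) \<Rightarrow> bool" where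
  "smooth_curve_on a b \<gamma> \<longleftrightarrow>
     (\<exists>\<gamma>'. continuous_on {a..b} \<gamma>' \<and>
        (\<forall>t\<in>{a..b}. (\<gamma> has_vector_derivative \<gamma>' t) (at t within {a..b}) \<and> \<gamma>' t \<noteq> 0))"

text \<open>Continuity on \<open>{a..b}\<close> is implied, since adjacent closed pieces share their end point.\<close>

definition piecewise_smooth_curve_on :: "real \<Rightarrow> real \<Rightarrow> (real \<Rightarrow> 'a::real_normed_vector) \<Rightarrow> bool" where
  "piecewise_smooth_curve_on a b \<gamma> \<longleftrightarrow> a < b \<and>
     (\<exists>n p. p 0 = a \<and> p n = b \<and>
        (\<forall>i<n. p i < p (Suc i) \<and> smooth_curve_on (p i) (p (Suc i)) \<gamma>))"

text \<open>
  At the finitely many break points, where \<open>\<gamma>\<close> need not be differentiable, the value of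
  \<^const>\<open>vector_derivative\<close> is unspecified; this does not affect the integral.
\<close>

definition curve_length :: "real \<Rightarrow> real \<Rightarrow> (real \<Rightarrow> 'a::real_normed_vector) \<Rightarrow> real" where
  "curve_length a b \<gamma> = integral {a..b} (\<lambda>t. norm (vector_derivative \<gamma> (at t within {a..b})))"

text \<open>The infimum is taken in \<^typ>\<open>ereal\<close>, so it is \<open>\<infinity>\<close> if no curve in the unitary group joins
  \<open>u\<close> to \<open>v\<close>.\<close>

definition d_infty :: "'a::unital_cstar_algebra \<Rightarrow> 'a \<Rightarrow> ereal" where
  "d_infty u v =
     Inf {ereal (curve_length a b \<gamma>) | a b \<gamma>.
            piecewise_smooth_curve_on a b \<gamma> \<and> (\<forall>t\<in>{a..b}. \<gamma> t \<in> unitary_group) \<and>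
            \<gamma> a = u \<and> \<gamma> b = v}"

definition geodesic_on :: "real set \<Rightarrow> (real \<Rightarrow> 'a::unital_cstar_algebra) \<Rightarrow> bool" where
  "geodesic_on I \<beta> \<longleftrightarrow>
     (\<exists>w\<in>unitary_group. \<exists>z. star z = - z \<and> (\<forall>s\<in>I. \<beta> s = w * exp (s *\<^sub>R z)))"

end

theory Submission
  imports Defs
begin

text \<open>
  For unitaries \<open>u\<close>, \<open>w\<close> at distance less than \<open>\<pi>/2\<close>, the distance is the largest angle through
  which the unitary \<open>v = u\<^sup>*w\<close> turns a vector, and \<open>d\<^sub>\<infinity>(u,w) = arcsin \<parallel>Im v\<parallel>\<close>. Two facts about angles
  give convexity: they obey the triangle inequality of the sphere and are unchanged by unitary
  conjugation, and squaring \<open>v\<close> doubles its largest angle, as long as that angle is below \<open>\<pi>/2\<close>.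

  Let \<open>\<beta>(m)\<close> be the midpoint of \<open>\<beta>(s)\<close> and \<open>\<beta>(t)\<close>. With \<open>v = u\<^sup>*\<beta>(m)\<close> and the unitary
  \<open>W = exp((t-s)z/2)\<close>, the end points are \<open>u\<^sup>*\<beta>(s) = vW\<^sup>*\<close> and \<open>u\<^sup>*\<beta>(t) = vW\<close>, and
  \<open>v\<^sup>2 = (vW\<^sup>*) \<cdot> W(vW)W\<^sup>*\<close>. Hence the angle of \<open>v\<^sup>2\<close> is at most the sum of the angles of \<open>vW\<^sup>*\<close> and
  \<open>vW\<close>, while it is twice the angle of \<open>v\<close>. This is midpoint convexity
  (\<open>arcsin_midpoint_le\<close>); since \<open>arcsin \<parallel>Im (u\<^sup>*\<beta>(s))\<parallel>\<close> is continuous in \<open>s\<close>, convexity follows.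

  Angles are measured in the inner product \<open>\<langle>x,y\<rangle> = Re \<tau>(x\<^sup>*y)\<close>, on which the algebra acts by left
  multiplication. The following points carry the argument.

  \<^item> Lower bound for the distance (\<open>cos_curve_length_le_ip\<close>). A curve \<open>\<gamma>\<close> of unitaries moves a unit
    vector \<open>x\<close> along the unit sphere with speed at most \<open>\<parallel>\<gamma>'\<parallel>\<close>, so \<open>\<gamma>\<close> is at least as long as the
    angle between \<open>\<gamma>(a)x\<close> and \<open>\<gamma>(b)x\<close>.

  \<^item> The norm of a self-adjoint element is its operator norm for this inner product
    (\<open>norm_le_if_ip_mult_self_le\<close>). If \<open>h\<close> is a contraction for the inner product, then \<open>1 - h\<^sup>2\<close> is
    the square of some self-adjoint \<open>c\<close> that commutes with \<open>h\<close>, and \<open>h\<close> is the real part of the unitary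
    \<open>h + ic\<close>. Here positivity in the sense of the inner product is converted into a square root
    inside the algebra, which rests on faithfulness.

  \<^item> Upper bound for the distance (\<open>d_infty_le_arcsin\<close>). With \<open>y = Im v\<close>, the curve
    \<open>t \<mapsto> u ((1 - t\<^sup>2y\<^sup>2)\<^sup>1\<^sup>/\<^sup>2 + i t y)\<close> runs from \<open>u\<close> to \<open>uv\<close>, and its speed is at most
    \<open>\<parallel>y\<parallel> / (1 - t\<^sup>2\<parallel>y\<parallel>\<^sup>2)\<^sup>1\<^sup>/\<^sup>2\<close>, the derivative of \<open>arcsin (t\<parallel>y\<parallel>)\<close>.

  Square roots in the algebra are values of the binomial series of \<open>(1 - x)\<^sup>1\<^sup>/\<^sup>2\<close>, which converges on
  the closed unit ball. This one series takes the place of a functional calculus.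
\<close>

section \<open>Binomial series in Banach algebras\<close>

definition one_minus_coeff :: "real \<Rightarrow> nat \<Rightarrow> real" where
  "one_minus_coeff a n = (-1) ^ n * (a gchoose n)"

text \<open>
  The power \<open>(1 - x)\<^sup>a\<close>, by its binomial series. For the exponents of interest,
  \<open>\<plusminus>1/2\<close>, the coefficients have constant sign from degree 1 on, so that estimates in norm reduce to real series.
\<close>

definition one_minus_power :: "real \<Rightarrow> 'a::{real_normed_algebra_1,banach} \<Rightarrow> 'a" where
  "one_minus_power a x = (\<Sum>n. one_minus_coeff a n *\<^sub>R x ^ n)"

lemma one_minus_coeff_0 [simp]: "one_minus_coeff a 0 = 1"
  by (simp add: one_minus_coeff_def)

lemma Suc_mult_one_minus_coeff_Suc:
  "real (Suc n) * one_minus_coeff a (Suc n) = - a * one_minus_coeff (a - 1) n"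
proof -
  have "real (Suc n) * one_minus_coeff a (Suc n) = - ((-1) ^ n * (real (Suc n) * (a gchoose Suc n)))"
    by (simp add: one_minus_coeff_def del: of_nat_Suc)
  then show ?thesis
    by (simp add: one_minus_coeff_def gbinomial_absorption del: of_nat_Suc)
qed

lemma sum_one_minus_coeff: "(\<Sum>k\<le>n. one_minus_coeff a k) = one_minus_coeff (a - 1) n"
  using gbinomial_sum_lower_neg[of a n] by (simp add: one_minus_coeff_def mult.commute)

text \<open>
  Vandermonde's identity; it makes the binomial series multiplicative in the exponent.
\<close>

lemma one_minus_coeff_convolution:
  "(\<Sum>i\<le>n. one_minus_coeff a i * one_minus_coeff b (n - i)) = one_minus_coeff (a + b) n"
proof -
  have "one_minus_coeff a i * one_minus_coeff b (n - i)
      = (-1) ^ n * ((a gchoose i) * (b gchoose (n - i)))" if "i \<le> n" for i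
  proof -
    have "(-1::real) ^ n = (-1) ^ i * (-1) ^ (n - i)"
      using that by (simp flip: power_add)
    then show ?thesis by (simp add: one_minus_coeff_def)
  qed
  then have "(\<Sum>i\<le>n. one_minus_coeff a i * one_minus_coeff b (n - i))
      = (-1) ^ n * (\<Sum>i\<le>n. (a gchoose i) * (b gchoose (n - i)))"
    by (simp add: sum_distrib_left)
  then show ?thesis
    using gbinomial_Vandermonde[of a b n] by (simp add: one_minus_coeff_def atLeast0AtMost)
qed

lemma one_minus_coeff_neg_half_nonneg: "0 \<le> one_minus_coeff (-1/2) n"
proof -
  have "one_minus_coeff (-1/2) n = (of_nat n - 1/2 gchoose n)"
    unfolding one_minus_coeff_def
    by (subst gbinomial_negated_upper) (simp flip: power_mult_distrib mult.assoc)
  also have "\<dots> \<ge> 0"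
    unfolding gbinomial_prod_rev by (intro divide_nonneg_nonneg prod_nonneg) auto
  finally show ?thesis .
qed

lemma one_minus_coeff_half_Suc_nonpos: "one_minus_coeff (1/2) (Suc n) \<le> 0"
proof -
  have "real (Suc n) * one_minus_coeff (1/2) (Suc n) \<le> 0"
    using one_minus_coeff_neg_half_nonneg[of n]
    by (subst Suc_mult_one_minus_coeff_Suc) simp
  then show ?thesis
    by (simp add: mult_le_0_iff del: of_nat_Suc)
qed

text \<open>
  The partial sums of the coefficients of \<open>(1 - x)\<^sup>1\<^sup>/\<^sup>2\<close> are the coefficients of \<open>(1 - x)\<^sup>-\<^sup>1\<^sup>/\<^sup>2\<close>, which
  are nonnegative. So the coefficients after the leading 1, all of them nonpositive, cannot add up to
  less than \<open>-1\<close>. This gives absolute convergence up to the boundary of the unit ball.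
\<close>

lemma sum_abs_one_minus_coeff_half_le:
  "(\<Sum>k<n. \<bar>one_minus_coeff (1/2) (Suc k)\<bar>) \<le> 1"
proof -
  have "(\<Sum>k<n. \<bar>one_minus_coeff (1/2) (Suc k)\<bar>) = - (\<Sum>k<n. one_minus_coeff (1/2) (Suc k))"
    using one_minus_coeff_half_Suc_nonpos by (simp add: abs_of_nonpos sum_negf)
  also have "\<dots> = 1 - (\<Sum>k\<le>n. one_minus_coeff (1/2) k)"
    by (simp add: sum.atMost_shift)
  also have "\<dots> = 1 - one_minus_coeff (-1/2) n"
    by (subst sum_one_minus_coeff) simp
  finally show ?thesis
    using one_minus_coeff_neg_half_nonneg[of n] by simp
qed

lemma one_minus_coeff_neg_half_le_1: "one_minus_coeff (-1/2) n \<le> 1"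
proof -
  have "one_minus_coeff (-1/2) n = (\<Sum>k\<le>n. one_minus_coeff (1/2) k)"
    by (subst sum_one_minus_coeff) simp
  also have "\<dots> = 1 + (\<Sum>k<n. one_minus_coeff (1/2) (Suc k))"
    by (simp add: sum.atMost_shift)
  also have "\<dots> \<le> 1"
    using one_minus_coeff_half_Suc_nonpos by (simp add: sum_nonpos)
  finally show ?thesis .
qed

lemma summable_abs_one_minus_coeff_half:
  "summable (\<lambda>n. \<bar>one_minus_coeff (1/2) (Suc n)\<bar>)" "(\<Sum>n. \<bar>one_minus_coeff (1/2) (Suc n)\<bar>) \<le> 1"
proof -
  show s: "summable (\<lambda>n. \<bar>one_minus_coeff (1/2) (Suc n)\<bar>)"
    by (rule summableI_nonneg_bounded[OF _ sum_abs_one_minus_coeff_half_le]) simp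
  show "(\<Sum>n. \<bar>one_minus_coeff (1/2) (Suc n)\<bar>) \<le> 1"
    by (rule suminf_le_const[OF s sum_abs_one_minus_coeff_half_le])
qed

lemma norm_one_minus_coeff_term_le:
  fixes x :: "'a::{real_normed_algebra_1,banach}"
  assumes "norm x \<le> 1"
  shows "norm (one_minus_coeff a n *\<^sub>R x ^ n) \<le> \<bar>one_minus_coeff a n\<bar>"
proof -
  have "norm (x ^ n) \<le> 1"
    using norm_power_ineq[of x n] power_le_one[of "norm x" n] assms by simp
  then show ?thesis
    using mult_left_mono[of "norm (x ^ n)" 1 "\<bar>one_minus_coeff a n\<bar>"] by simp
qed

lemma summable_one_minus_power_half:
  fixes x :: "'a::{real_normed_algebra_1,banach}"
  assumes "norm x \<le> 1"
  shows "summable (\<lambda>n. norm (one_minus_coeff (1/2) n *\<^sub>R x ^ n))"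
proof (rule summable_comparison_test')
  show "summable (\<lambda>n. \<bar>one_minus_coeff (1/2) n\<bar>)"
    using summable_abs_one_minus_coeff_half(1) by (subst (asm) summable_Suc_iff)
  show "norm (norm (one_minus_coeff (1/2) n *\<^sub>R x ^ n)) \<le> \<bar>one_minus_coeff (1/2) n\<bar>"
    if "n \<ge> 0" for n
    using norm_one_minus_coeff_term_le[OF assms] by simp
qed

lemma norm_one_minus_coeff_neg_half_term_le:
  fixes x :: "'a::{real_normed_algebra_1,banach}"
  shows "norm (one_minus_coeff (-1/2) n *\<^sub>R x ^ n) \<le> norm x ^ n"
proof -
  have "norm (one_minus_coeff (-1/2) n *\<^sub>R x ^ n) = one_minus_coeff (-1/2) n * norm (x ^ n)"
    using one_minus_coeff_neg_half_nonneg[of n] by simp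
  also have "\<dots> \<le> 1 * norm x ^ n"
    by (intro mult_mono one_minus_coeff_neg_half_le_1 norm_power_ineq) auto
  finally show ?thesis by simp
qed

lemma summable_one_minus_power_neg_half:
  fixes x :: "'a::{real_normed_algebra_1,banach}"
  assumes "norm x < 1"
  shows "summable (\<lambda>n. norm (one_minus_coeff (-1/2) n *\<^sub>R x ^ n))"
  by (rule summable_comparison_test'[where g = "\<lambda>n. norm x ^ n"])
     (use assms norm_one_minus_coeff_neg_half_term_le[of _ x] in auto)

lemma one_minus_power_mult:
  fixes x :: "'a::{real_normed_algebra_1,banach}"
  assumes "summable (\<lambda>n. norm (one_minus_coeff a n *\<^sub>R x ^ n))"
    and "summable (\<lambda>n. norm (one_minus_coeff b n *\<^sub>R x ^ n))"
  shows "one_minus_power a x * one_minus_power b x = one_minus_power (a + b) x"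
proof -
  have "(\<Sum>i\<le>n. (one_minus_coeff a i *\<^sub>R x ^ i) * (one_minus_coeff b (n - i) *\<^sub>R x ^ (n - i)))
      = one_minus_coeff (a + b) n *\<^sub>R x ^ n" for n
  proof -
    have "(\<Sum>i\<le>n. (one_minus_coeff a i *\<^sub>R x ^ i) * (one_minus_coeff b (n - i) *\<^sub>R x ^ (n - i)))
      = (\<Sum>i\<le>n. (one_minus_coeff a i * one_minus_coeff b (n - i)) *\<^sub>R x ^ n)"
      by (intro sum.cong) (auto simp flip: power_add simp: mult.commute)
    then show ?thesis
      by (simp add: one_minus_coeff_convolution flip: scaleR_left.sum)
  qed
  then show ?thesis
    unfolding one_minus_power_def using Cauchy_product[OF assms] by simp
qed

lemma one_minus_power_exponent_0 [simp]: "one_minus_power 0 x = 1"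
proof -
  have "one_minus_power 0 x = (\<Sum>n\<in>{0}. one_minus_coeff 0 n *\<^sub>R x ^ n)"
    unfolding one_minus_power_def
  proof (rule suminf_finite)
    show "one_minus_coeff 0 n *\<^sub>R x ^ n = 0" if "n \<notin> {0}" for n
      using that by (cases n) (auto simp: one_minus_coeff_def)
  qed simp
  then show ?thesis by simp
qed

lemma one_minus_power_zero [simp]: "one_minus_power a 0 = 1"
proof -
  have "one_minus_power a (0::'a) = (\<Sum>n\<in>{0}. one_minus_coeff a n *\<^sub>R 0 ^ n)"
    unfolding one_minus_power_def by (rule suminf_finite) (auto simp: power_0_left)
  then show ?thesis by simp
qed

lemma one_minus_power_exponent_1 [simp]: "one_minus_power 1 x = 1 - x"
proof -
  have "one_minus_power 1 x = (\<Sum>n\<in>{0,1}. one_minus_coeff 1 n *\<^sub>R x ^ n)"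
    unfolding one_minus_power_def
  proof (rule suminf_finite)
    show "one_minus_coeff 1 n *\<^sub>R x ^ n = 0" if "n \<notin> {0,1}" for n
    proof -
      have "1 choose n = 0"
        using that by (intro binomial_eq_0) auto
      then have "(1::real) gchoose n = 0"
        using binomial_gbinomial[of 1 n, where ?'a = real] by (metis of_nat_0 of_nat_1)
      then show ?thesis by (simp add: one_minus_coeff_def)
    qed
  qed simp
  then show ?thesis by (simp add: one_minus_coeff_def)
qed

lemma one_minus_power_half_squared:
  fixes x :: "'a::{real_normed_algebra_1,banach}"
  assumes "norm x \<le> 1"
  shows "one_minus_power (1/2) x * one_minus_power (1/2) x = 1 - x"
  using one_minus_power_mult[OF summable_one_minus_power_half summable_one_minus_power_half] assms
  by simp

lemma one_minus_power_neg_half_mult_half: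
  fixes x :: "'a::{real_normed_algebra_1,banach}"
  assumes "norm x < 1"
  shows "one_minus_power (-1/2) x * one_minus_power (1/2) x = 1"
  using one_minus_power_mult[OF summable_one_minus_power_neg_half[OF assms]
      summable_one_minus_power_half[OF less_imp_le[OF assms]]]
  by simp

text \<open>
  Closedness under iteration: \<open>1 - (1 - x)\<^sup>1\<^sup>/\<^sup>2\<close> lies again in the unit ball, so that the root has
  itself a root given by the same series.
\<close>

lemma norm_one_minus_one_minus_power_half_le:
  fixes x :: "'a::{real_normed_algebra_1,banach}"
  assumes "norm x \<le> 1"
  shows "norm (1 - one_minus_power (1/2) x) \<le> 1"
proof -
  let ?t = "\<lambda>n. one_minus_coeff (1/2) n *\<^sub>R x ^ n"
  note sm = summable_one_minus_power_half[OF assms]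
  have "one_minus_power (1/2) x = ?t 0 + (\<Sum>n. ?t (Suc n))"
    unfolding one_minus_power_def
    using suminf_split_head[OF summable_norm_cancel[OF sm]] by simp
  then have "norm (1 - one_minus_power (1/2) x) = norm (\<Sum>n. ?t (Suc n))"
    by simp
  also have "\<dots> \<le> (\<Sum>n. norm (?t (Suc n)))"
    by (intro summable_norm) (use sm in \<open>simp only: summable_Suc_iff[of "\<lambda>n. norm (?t n)"]\<close>)
  also have "\<dots> \<le> (\<Sum>n. \<bar>one_minus_coeff (1/2) (Suc n)\<bar>)"
  proof (rule suminf_le)
    show "norm (?t (Suc n)) \<le> \<bar>one_minus_coeff (1/2) (Suc n)\<bar>" for n
      by (rule norm_one_minus_coeff_term_le[OF assms])
    show "summable (\<lambda>n. norm (?t (Suc n)))"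
      using sm by (simp only: summable_Suc_iff[of "\<lambda>n. norm (?t n)"])
  qed (rule summable_abs_one_minus_coeff_half(1))
  also have "\<dots> \<le> 1"
    by (rule summable_abs_one_minus_coeff_half(2))
  finally show ?thesis .
qed

lemma one_minus_power_commute:
  fixes x :: "'a::{real_normed_algebra_1,banach}"
  assumes "summable (\<lambda>n. norm (one_minus_coeff a n *\<^sub>R x ^ n))" and "x * z = z * x"
  shows "one_minus_power a x * z = z * one_minus_power a x"
proof -
  note sm = summable_norm_cancel[OF assms(1)]
  have "x ^ n * z = z * x ^ n" for n
    by (rule power_commuting_commutes[OF assms(2)])
  then show ?thesis
    unfolding one_minus_power_def suminf_mult[OF sm, symmetric] suminf_mult2[OF sm]
    by simp
qed

lemma one_minus_power_neg_half_real:
  assumes "\<bar>r\<bar> < 1"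
  shows "one_minus_power (-1/2) r = 1 / sqrt (1 - r)"
proof -
  let ?p = "one_minus_power (1/2) r"
  have sq: "?p * ?p = 1 - r" and inv: "one_minus_power (-1/2) r * ?p = 1"
    using one_minus_power_half_squared[of r] one_minus_power_neg_half_mult_half[of r] assms by auto
  have "\<bar>1 - ?p\<bar> \<le> 1"
    using norm_one_minus_one_minus_power_half_le[of r] assms by simp
  then have "?p \<ge> 0" by linarith
  then have "?p = sqrt (1 - r)"
    using sq by (metis real_sqrt_mult_self real_sqrt_abs2 abs_of_nonneg)
  with inv show ?thesis
    by (metis mult_zero_right nonzero_eq_divide_eq zero_neq_one)
qed

text \<open>
  The coefficients are nonnegative, so the norm of the series is at most its value at a real number.
\<close>

lemma norm_one_minus_power_neg_half_le:
  fixes x :: "'a::{real_normed_algebra_1,banach}"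
  assumes "norm x \<le> r" "r < 1"
  shows "norm (one_minus_power (-1/2) x) \<le> 1 / sqrt (1 - r)"
proof -
  have r: "0 \<le> r" using assms(1) norm_ge_zero order_trans by blast
  have sm: "summable (\<lambda>n. norm (one_minus_coeff (-1/2) n *\<^sub>R x ^ n))"
    using summable_one_minus_power_neg_half assms by force
  have smr: "summable (\<lambda>n. norm (one_minus_coeff (-1/2) n *\<^sub>R r ^ n))"
    using summable_one_minus_power_neg_half[of r] assms r by simp
  have "norm (one_minus_power (-1/2) x) \<le> (\<Sum>n. norm (one_minus_coeff (-1/2) n *\<^sub>R x ^ n))"
    unfolding one_minus_power_def by (rule summable_norm[OF sm])
  also have "\<dots> \<le> (\<Sum>n. one_minus_coeff (-1/2) n *\<^sub>R r ^ n)"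
  proof (rule suminf_le[OF _ sm summable_norm_cancel[OF smr]])
    show "norm (one_minus_coeff (-1/2) n *\<^sub>R x ^ n) \<le> one_minus_coeff (-1/2) n *\<^sub>R r ^ n" for n
      using one_minus_coeff_neg_half_nonneg[of n] norm_power_ineq[of x n]
        power_mono[OF assms(1) norm_ge_zero, of n] by (auto intro!: mult_left_mono)
  qed
  also have "\<dots> = 1 / sqrt (1 - r)"
    using one_minus_power_neg_half_real[of r] assms r by (simp add: one_minus_power_def)
  finally show ?thesis .
qed

lemma continuous_on_one_minus_power_neg_half:
  fixes q :: "'a::{real_normed_algebra_1,banach}"
  assumes "norm q < 1"
  shows "continuous_on {0..1} (\<lambda>t. one_minus_power (-1/2) (t\<^sup>2 *\<^sub>R q))"
proof -
  let ?f = "\<lambda>n t. one_minus_coeff (-1/2) n *\<^sub>R (t\<^sup>2 *\<^sub>R q) ^ n"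
  have "uniform_limit {0..1} (\<lambda>n t. \<Sum>i<n. ?f i t) (\<lambda>t. suminf (\<lambda>i. ?f i t)) sequentially"
  proof (rule Weierstrass_m_test)
    show "norm (?f n t) \<le> norm q ^ n" if t: "t \<in> {0..1}" for n t
    proof -
      have "norm (?f n t) \<le> norm (t\<^sup>2 *\<^sub>R q) ^ n"
        by (rule norm_one_minus_coeff_neg_half_term_le)
      also have "\<dots> \<le> norm q ^ n"
        by (rule power_mono) (use t in \<open>auto simp: power_le_one mult_left_le_one_le\<close>)
      finally show ?thesis .
    qed
    show "summable (\<lambda>n. norm q ^ n)" using assms by simp
  qed
  then show ?thesis
    unfolding one_minus_power_def
    by (rule uniform_limit_theorem[rotated]) (auto intro!: always_eventually continuous_intros)
qed

text \<open>
  Termwise differentiation: every term is a power of \<open>q\<close> with a real function of \<open>t\<close> as coefficient.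
\<close>

lemma has_vector_derivative_one_minus_power_half:
  fixes q :: "'a::{real_normed_algebra_1,banach}"
  assumes "norm q < 1" and t: "t \<in> {0..1}"
  shows "((\<lambda>t. one_minus_power (1/2) (t\<^sup>2 *\<^sub>R q)) has_vector_derivative
           (- t) *\<^sub>R (q * one_minus_power (-1/2) (t\<^sup>2 *\<^sub>R q))) (at t within {0..1})"
proof -
  let ?f = "\<lambda>n t. one_minus_coeff (1/2) n *\<^sub>R (t\<^sup>2 *\<^sub>R q) ^ n"
  let ?d = "\<lambda>n t. (one_minus_coeff (1/2) n * (real (2 * n) * t ^ (2 * n - 1))) *\<^sub>R q ^ n"
  let ?g = "\<lambda>t. (- t) *\<^sub>R (q * one_minus_power (-1/2) (t\<^sup>2 *\<^sub>R q))"
  have small: "norm (t\<^sup>2 *\<^sub>R q) < 1" if "t \<in> {0..1}" for t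
  proof -
    have "norm (t\<^sup>2 *\<^sub>R q) \<le> norm q"
      using that by (auto simp: power_le_one mult_left_le_one_le)
    then show ?thesis using assms by simp
  qed
  have dSuc: "?d (Suc n) t = (- t) *\<^sub>R (q * (one_minus_coeff (-1/2) n *\<^sub>R (t\<^sup>2 *\<^sub>R q) ^ n))" for n t
  proof -
    have "one_minus_coeff (1/2) (Suc n) * real (2 * Suc n) = - one_minus_coeff (-1/2) n"
      using Suc_mult_one_minus_coeff_Suc[of n "1/2"] by (simp add: algebra_simps)
    then have "one_minus_coeff (1/2) (Suc n) * (real (2 * Suc n) * t ^ (2 * Suc n - 1))
        = - one_minus_coeff (-1/2) n * t ^ (2 * Suc n - 1)"
      by (metis mult.assoc)
    then have "?d (Suc n) t = (- one_minus_coeff (-1/2) n * t ^ (2 * Suc n - 1)) *\<^sub>R q ^ Suc n"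
      by simp
    also have "\<dots> = (- t) *\<^sub>R (q * (one_minus_coeff (-1/2) n *\<^sub>R (t\<^sup>2 *\<^sub>R q) ^ n))"
      by (simp add: power_mult power2_eq_square power_mult_distrib mult_ac)
    finally show ?thesis .
  qed
  have dsums: "(\<lambda>n. ?d n t) sums ?g t" if "t \<in> {0..1}" for t
  proof -
    have "(\<lambda>n. one_minus_coeff (-1/2) n *\<^sub>R (t\<^sup>2 *\<^sub>R q) ^ n) sums one_minus_power (-1/2) (t\<^sup>2 *\<^sub>R q)"
      unfolding one_minus_power_def
      by (rule summable_sums[OF summable_norm_cancel[OF summable_one_minus_power_neg_half[OF small[OF that]]]])
    then have "(\<lambda>n. ?d (Suc n) t) sums ?g t"
      unfolding dSuc using sums_scaleR_right[OF sums_mult, of _ _ "- t" q] by blast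
    then show ?thesis
      by (subst (asm) sums_Suc_iff) simp
  qed
  have lim: "uniform_limit {0..1} (\<lambda>n t. \<Sum>i<n. ?d i t) (\<lambda>t. suminf (\<lambda>i. ?d i t)) sequentially"
  proof (rule Weierstrass_m_test)
    show "norm (?d n t) \<le> norm q ^ n" if t: "t \<in> {0..1}" for n t
    proof (cases n)
      case (Suc m)
      have "norm (?d n t) = \<bar>t\<bar> * norm (q * (one_minus_coeff (-1/2) m *\<^sub>R (t\<^sup>2 *\<^sub>R q) ^ m))"
        unfolding Suc dSuc by (simp add: abs_mult)
      also have "\<dots> \<le> 1 * (norm q * norm (one_minus_coeff (-1/2) m *\<^sub>R (t\<^sup>2 *\<^sub>R q) ^ m))"
        using t by (intro mult_mono norm_mult_ineq) auto
      also have "\<dots> \<le> 1 * (norm q * norm (t\<^sup>2 *\<^sub>R q) ^ m)"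
        by (intro mult_left_mono norm_one_minus_coeff_neg_half_term_le) auto
      also have "\<dots> \<le> 1 * (norm q * norm q ^ m)"
        using t by (intro mult_left_mono power_mono) (auto simp: power_le_one mult_left_le_one_le)
      finally show ?thesis using Suc by simp
    qed simp
    show "summable (\<lambda>n. norm q ^ n)" using assms by simp
  qed
  have "\<exists>g. \<forall>x\<in>{0..1}. (\<lambda>n. ?f n x) sums (g x) \<and>
          (g has_derivative (\<lambda>h. h *\<^sub>R ?g x)) (at x within {0..1})"
  proof (rule has_derivative_series[where f' = "\<lambda>n x h. h *\<^sub>R ?d n x"])
    show "(?f n has_derivative (\<lambda>h. h *\<^sub>R ?d n x)) (at x within {0..1})" for n x
    proof -
      have e: "?f n = (\<lambda>x. (one_minus_coeff (1/2) n * x ^ (2 * n)) *\<^sub>R q ^ n)"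
        by (simp add: fun_eq_iff power_mult)
      have "((\<lambda>x. (one_minus_coeff (1/2) n * x ^ (2 * n)) *\<^sub>R q ^ n) has_vector_derivative ?d n x)
              (at x within {0..1})"
        by (auto intro!: derivative_eq_intros)
      then show ?thesis unfolding e has_vector_derivative_def .
    qed
    show "\<forall>\<^sub>F n in sequentially. \<forall>x\<in>{0..1}. \<forall>h.
            norm ((\<Sum>i<n. h *\<^sub>R ?d i x) - h *\<^sub>R ?g x) \<le> e * norm h" if "e > 0" for e
      using uniform_limitD[OF lim that]
    proof (rule eventually_mono, intro ballI allI)
      fix n x h assume *: "\<forall>x\<in>{0..1}. dist (\<Sum>i<n. ?d i x) (\<Sum>i. ?d i x) < e" and x: "x \<in> {0..1::real}"
      have "norm ((\<Sum>i<n. h *\<^sub>R ?d i x) - h *\<^sub>R ?g x) = \<bar>h\<bar> * dist (\<Sum>i<n. ?d i x) (\<Sum>i. ?d i x)"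
        unfolding sums_unique[OF dsums[OF x]] dist_norm scaleR_sum_right[symmetric]
          scaleR_diff_right[symmetric] norm_scaleR ..
      also have "\<dots> \<le> \<bar>h\<bar> * e"
        using * x by (intro mult_left_mono) (auto intro: less_imp_le)
      finally show "norm ((\<Sum>i<n. h *\<^sub>R ?d i x) - h *\<^sub>R ?g x) \<le> e * norm h" by (simp add: mult.commute)
    qed
    show "(\<lambda>n. ?f n t) sums one_minus_power (1/2) (t\<^sup>2 *\<^sub>R q)"
      unfolding one_minus_power_def
      by (rule summable_sums[OF summable_norm_cancel[OF summable_one_minus_power_half[OF less_imp_le[OF small[OF t]]]]])
  qed (use t in auto)
  then obtain g where g: "\<And>x. x \<in> {0..1} \<Longrightarrow> (\<lambda>n. ?f n x) sums (g x)"
    "\<And>x. x \<in> {0..1} \<Longrightarrow> (g has_vector_derivative ?g x) (at x within {0..1})"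
    unfolding has_vector_derivative_def by blast
  have "one_minus_power (1/2) (x\<^sup>2 *\<^sub>R q) = g x" if "x \<in> {0..1}" for x
    unfolding one_minus_power_def using sums_unique[OF g(1)[OF that]] by simp
  then show ?thesis
    using has_vector_derivative_transform[OF t _ g(2)[OF t]] by metis
qed

section \<open>Self-adjoint and unitary elements\<close>

lemma scaleC_one [simp]: "1 *\<^sub>C x = (x::'a::unital_cstar_algebra)"
  using scaleC_of_real[of 1 x] by simp

lemma scaleC_scaleR_commute: "c *\<^sub>C (r *\<^sub>R x) = r *\<^sub>R (c *\<^sub>C (x::'a::unital_cstar_algebra))"
  by (simp add: scaleC_scaleC mult.commute flip: scaleC_of_real)

lemma bounded_linear_scaleC: "bounded_linear (\<lambda>x::'a::unital_cstar_algebra. c *\<^sub>C x)"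
  by (rule bounded_linear_intro[where K = "cmod c"])
     (simp_all add: scaleC_add_right scaleC_scaleR_commute norm_scaleC mult.commute)

lemma bounded_linear_scaleC_left: "bounded_linear (\<lambda>c. c *\<^sub>C (x::'a::unital_cstar_algebra))"
  by (rule bounded_linear_intro[where K = "norm x"])
     (simp_all add: scaleC_add_left norm_scaleC scaleR_conv_of_real scaleC_of_real flip: scaleC_scaleC)

lemmas scaleC_zero_right [simp] = linear_0[OF bounded_linear.linear[OF bounded_linear_scaleC]]
  and scaleC_diff_right = linear_diff[OF bounded_linear.linear[OF bounded_linear_scaleC]]
  and scaleC_minus_left = linear_neg[OF bounded_linear.linear[OF bounded_linear_scaleC_left]]

lemma star_scaleR: "star (r *\<^sub>R x) = r *\<^sub>R star (x::'a::unital_cstar_algebra)"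
  using star_scaleC[of "of_real r" x] by (simp add: scaleC_of_real)

lemma norm_star [simp]: "norm (star x) = norm (x::'a::unital_cstar_algebra)"
proof -
  have le: "norm y \<le> norm (star y)" for y :: 'a
  proof (cases "y = 0")
    case False
    have "norm y * norm y = norm (star y * y)"
      by (simp add: cstar_identity power2_eq_square)
    also have "\<dots> \<le> norm (star y) * norm y" by (rule norm_mult_ineq)
    finally show ?thesis using False by simp
  qed simp
  show ?thesis using le[of x] le[of "star x"] by (simp add: star_star)
qed

lemma bounded_linear_star: "bounded_linear (star :: 'a::unital_cstar_algebra \<Rightarrow> 'a)"
  by (rule bounded_linear_intro[where K = 1]) (simp_all add: star_add star_scaleR)

lemmas star_zero [simp] = linear_0[OF bounded_linear.linear[OF bounded_linear_star]]
  and star_diff = linear_diff[OF bounded_linear.linear[OF bounded_linear_star]]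

lemma star_one [simp]: "star 1 = (1::'a::unital_cstar_algebra)"
  by (metis mult.left_neutral mult.right_neutral star_mult star_star)

lemma star_power: "star (x ^ n) = star (x::'a::unital_cstar_algebra) ^ n"
  by (induction n) (simp_all add: star_mult power_commutes)

lemma eq_zero_if_self_adjoint_square_zero:
  "star x = x \<Longrightarrow> x * x = 0 \<Longrightarrow> x = (0::'a::unital_cstar_algebra)"
  using cstar_identity[of x] by simp

lemma unitary_groupD:
  "u \<in> unitary_group \<Longrightarrow> star u * u = 1" "u \<in> unitary_group \<Longrightarrow> u * star u = 1"
  by (simp_all add: unitary_group_def)

lemma unitary_group_cancel:
  "u \<in> unitary_group \<Longrightarrow> star u * (u * x) = x" "u \<in> unitary_group \<Longrightarrow> u * (star u * x) = x"
  by (simp_all add: unitary_groupD flip: mult.assoc)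

lemma unitary_group_star: "u \<in> unitary_group \<Longrightarrow> star u \<in> unitary_group"
  by (simp add: unitary_group_def star_star)

lemma unitary_group_mult: "u \<in> unitary_group \<Longrightarrow> v \<in> unitary_group \<Longrightarrow> u * v \<in> unitary_group"
proof -
  assume u: "u \<in> unitary_group" and v: "v \<in> unitary_group"
  have "star (u * v) * (u * v) = star v * (star u * (u * v))"
    and "u * v * star (u * v) = u * (v * (star v * star u))"
    by (simp_all add: star_mult mult.assoc)
  then show "u * v \<in> unitary_group"
    by (simp add: unitary_group_def unitary_group_cancel[OF u] unitary_group_cancel[OF v]
        unitary_groupD[OF u] unitary_groupD[OF v])
qed

lemma norm_unitary: "u \<in> unitary_group \<Longrightarrow> norm u = 1"
  using cstar_identity[of u] norm_ge_zero[of u]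
  by (auto simp: unitary_groupD power2_eq_1_iff)

definition re_part :: "'a::unital_cstar_algebra \<Rightarrow> 'a" where
  "re_part a = (1/2) *\<^sub>R (a + star a)"

definition im_part :: "'a::unital_cstar_algebra \<Rightarrow> 'a" where
  "im_part a = (1/2) *\<^sub>R (-\<i>) *\<^sub>C (a - star a)"

lemma star_re_part [simp]: "star (re_part a) = re_part a"
  by (simp add: re_part_def star_scaleR star_add star_star add.commute)

lemma star_im_part [simp]: "star (im_part a) = im_part a"
  by (simp add: im_part_def star_scaleR star_scaleC star_diff star_star scaleC_diff_right scaleC_minus_left)

lemma re_part_add_im_part: "a = re_part a + \<i> *\<^sub>C im_part a"
proof -
  have "\<i> *\<^sub>C im_part a = (1/2) *\<^sub>R (a - star a)"
    by (simp add: im_part_def scaleC_scaleR_commute scaleC_scaleC)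
  then have "re_part a + \<i> *\<^sub>C im_part a = (1/2) *\<^sub>R (a + a)"
    by (simp add: re_part_def flip: scaleR_add_right)
  then show ?thesis by (simp flip: scaleR_2)
qed

lemma re_im_part_eqI:
  assumes "star h = h" "star k = k" "a = h + \<i> *\<^sub>C k"
  shows "re_part a = h" "im_part a = k"
proof -
  have s: "star a = h - \<i> *\<^sub>C k"
    using assms by (simp add: star_add star_scaleC scaleC_minus_left)
  show "re_part a = h" unfolding re_part_def s unfolding assms(3) by (simp flip: scaleR_2)
  have "a - star a = 2 *\<^sub>R (\<i> *\<^sub>C k)" unfolding s unfolding assms(3) by (simp add: scaleR_2)
  then show "im_part a = k" unfolding im_part_def
    by (simp add: scaleC_scaleR_commute scaleC_scaleC)
qed

lemma norm_re_part_le: "norm (re_part a) \<le> norm a"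
  using norm_triangle_ineq[of a "star a"] by (simp add: re_part_def)

lemma norm_im_part_le: "norm (im_part a) \<le> norm a"
  using norm_triangle_ineq4[of a "star a"] by (simp add: im_part_def norm_scaleC)

text \<open>
  The source of every norm bound on self-adjoint elements below: a commuting self-adjoint pair with
  \<open>h\<^sup>2 + k\<^sup>2 = 1\<close> consists of the real and imaginary part of a unitary, hence of elements of norm at
  most 1.
\<close>

lemma unitary_add_i_mult:
  fixes h k :: "'a::unital_cstar_algebra"
  assumes "star h = h" "star k = k" "h * k = k * h" "h * h + k * k = 1"
  shows "h + \<i> *\<^sub>C k \<in> unitary_group"
proof -
  have s: "star (h + \<i> *\<^sub>C k) = h - \<i> *\<^sub>C k"
    using assms by (simp add: star_add star_scaleC scaleC_minus_left)
  have kk: "(\<i> *\<^sub>C k) * (\<i> *\<^sub>C k) = - (k * k)"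
    using scaleC_of_real[of "-1" "k * k"] by (simp add: mult_scaleC_left mult_scaleC_right scaleC_scaleC)
  have hk: "h * (\<i> *\<^sub>C k) = (\<i> *\<^sub>C k) * h"
    by (simp add: mult_scaleC_left mult_scaleC_right assms)
  show ?thesis
    using assms(4) kk hk by (simp add: unitary_group_def s algebra_simps)
qed

lemma unitary_re_im_part:
  fixes v :: "'a::unital_cstar_algebra"
  assumes "v \<in> unitary_group"
  shows "re_part v * im_part v = im_part v * re_part v"
    and "re_part v * re_part v + im_part v * im_part v = 1"
proof -
  have v: "v * star v = 1" "star v * v = 1" using assms by (simp_all add: unitary_groupD)
  show "re_part v * im_part v = im_part v * re_part v"
  proof -
    have "(v + star v) * (v - star v) = (v - star v) * (v + star v)"
      by (simp add: algebra_simps v)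
    then show ?thesis
      by (simp add: re_part_def im_part_def mult_scaleC_left mult_scaleC_right scaleC_scaleR_commute)
  qed
  have "((-\<i>) *\<^sub>C (v - star v)) * ((-\<i>) *\<^sub>C (v - star v)) = - ((v - star v) * (v - star v))"
    using scaleC_of_real[of "-1" "(v - star v) * (v - star v)"]
    by (simp add: mult_scaleC_left mult_scaleC_right scaleC_scaleC)
  then have "im_part v * im_part v = (1/4) *\<^sub>R (- ((v - star v) * (v - star v)))"
    by (simp add: im_part_def)
  moreover have "re_part v * re_part v = (1/4) *\<^sub>R ((v + star v) * (v + star v))"
    by (simp add: re_part_def)
  ultimately have "re_part v * re_part v + im_part v * im_part v
      = (1/4) *\<^sub>R ((v + star v) * (v + star v) - (v - star v) * (v - star v))"
    by (simp add: scaleR_diff_right)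
  also have "(v + star v) * (v + star v) - (v - star v) * (v - star v) = 4 *\<^sub>R 1"
    by (simp add: algebra_simps v scaleR_conv_of_real)
  finally show "re_part v * re_part v + im_part v * im_part v = 1" by simp
qed

section \<open>Square roots of squares of self-adjoint elements\<close>

lemma star_one_minus_power:
  fixes x :: "'a::unital_cstar_algebra"
  assumes "summable (\<lambda>n. norm (one_minus_coeff a n *\<^sub>R x ^ n))" and "star x = x"
  shows "star (one_minus_power a x) = one_minus_power a x"
  unfolding one_minus_power_def bounded_linear.suminf[OF bounded_linear_star summable_norm_cancel[OF assms(1)]]
  by (simp add: star_scaleR star_power assms)

lemma star_one_minus_power_half:
  "norm x \<le> 1 \<Longrightarrow> star x = x \<Longrightarrow> star (one_minus_power (1/2) x) = one_minus_power (1/2) x"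
  by (rule star_one_minus_power[OF summable_one_minus_power_half])

lemma norm_mult_self_le_1:
  fixes y :: "'a::real_normed_algebra"
  assumes "norm y \<le> 1"
  shows "norm (y * y) \<le> 1"
  using norm_mult_ineq[of y y] mult_mono[of "norm y" 1 "norm y" 1] assms by simp

text \<open>
  With \<open>b = (1 - y\<^sup>2)\<^sup>1\<^sup>/\<^sup>2\<close> the element \<open>y + ib\<close> is unitary, so \<open>\<parallel>b\<parallel> \<le> 1\<close>. The estimate is what allows
  the binomial series to produce a root of \<open>y\<^sup>2\<close>.
\<close>

lemma norm_one_minus_square_le:
  fixes y :: "'a::unital_cstar_algebra"
  assumes "star y = y" "norm y \<le> 1"
  shows "norm (1 - y * y) \<le> 1"
proof -
  note n = norm_mult_self_le_1[OF assms(2)]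
  define b where "b = one_minus_power (1/2) (y * y)"
  have sb: "star b = b"
    unfolding b_def by (rule star_one_minus_power_half[OF n]) (simp add: star_mult assms)
  have bb: "b * b = 1 - y * y"
    unfolding b_def by (rule one_minus_power_half_squared[OF n])
  have comm: "b * y = y * b"
    unfolding b_def by (rule one_minus_power_commute[OF summable_one_minus_power_half[OF n]])
      (simp add: mult.assoc)
  have "norm b \<le> norm (y + \<i> *\<^sub>C b)"
    using norm_im_part_le[of "y + \<i> *\<^sub>C b"] re_im_part_eqI[OF assms(1) sb refl] by simp
  also have "\<dots> = 1"
    by (intro norm_unitary unitary_add_i_mult assms sb) (simp_all add: comm bb)
  finally show ?thesis
    using norm_mult_self_le_1[of b] by (simp add: bb)
qed

text \<open>
  The element \<open>c\<close> is \<open>\<bar>y\<bar>\<^sup>1\<^sup>/\<^sup>2\<close>: after scaling \<open>y\<close> into the unit ball, \<open>\<bar>y\<bar>\<close> is the root of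
  \<open>y\<^sup>2 = 1 - (1 - y\<^sup>2)\<close>, and it lies within distance 1 of the unit, so it has a root as well. The latter
  exhibits \<open>\<bar>y\<bar> = c\<^sup>*c\<close> as positive.
\<close>

lemma self_adjoint_sqrt_abs:
  fixes y :: "'a::unital_cstar_algebra"
  assumes "star y = y"
  obtains c where "star c = c" "(c * c) * (c * c) = y * y"
    "\<And>z. y * z = z * y \<Longrightarrow> c * z = z * c"
proof (cases "y = 0")
  case True
  then show ?thesis using that[of 0] by simp
next
  case False
  define y1 where "y1 = (1 / norm y) *\<^sub>R y"
  have y1: "star y1 = y1" "norm y1 \<le> 1"
    using False by (simp_all add: y1_def star_scaleR assms)
  have y: "y = norm y *\<^sub>R y1" using False by (simp add: y1_def)
  note n1 = norm_one_minus_square_le[OF y1]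
  define k where "k = one_minus_power (1/2) (1 - y1 * y1)"
  have sk: "star k = k"
    unfolding k_def by (rule star_one_minus_power_half[OF n1]) (simp add: star_diff star_mult y1)
  have kk: "k * k = y1 * y1"
    unfolding k_def one_minus_power_half_squared[OF n1] by simp
  have kc: "k * z = z * k" if "y1 * z = z * y1" for z
    unfolding k_def
  proof (rule one_minus_power_commute[OF summable_one_minus_power_half[OF n1]])
    have "y1 * y1 * z = z * (y1 * y1)" by (metis that mult.assoc)
    then show "(1 - y1 * y1) * z = z * (1 - y1 * y1)"
      by (simp add: left_diff_distrib right_diff_distrib)
  qed
  have n2: "norm (1 - k) \<le> 1"
    unfolding k_def by (rule norm_one_minus_one_minus_power_half_le[OF n1])
  define d where "d = one_minus_power (1/2) (1 - k)"
  have sd: "star d = d"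
    unfolding d_def by (rule star_one_minus_power_half[OF n2]) (simp add: star_diff sk)
  have dd: "d * d = k"
    unfolding d_def one_minus_power_half_squared[OF n2] by simp
  have dc: "d * z = z * d" if "y1 * z = z * y1" for z
    unfolding d_def
    by (rule one_minus_power_commute[OF summable_one_minus_power_half[OF n2]])
       (simp add: algebra_simps kc[OF that])
  show ?thesis
  proof (rule that[of "sqrt (norm y) *\<^sub>R d"])
    show "star (sqrt (norm y) *\<^sub>R d) = sqrt (norm y) *\<^sub>R d" by (simp add: star_scaleR sd)
    have "(sqrt (norm y) *\<^sub>R d) * (sqrt (norm y) *\<^sub>R d) = norm y *\<^sub>R k" by (simp add: dd)
    moreover have "(norm y *\<^sub>R k) * (norm y *\<^sub>R k) = y * y"
      using False by (simp add: kk y1_def)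
    ultimately show "(sqrt (norm y) *\<^sub>R d) * (sqrt (norm y) *\<^sub>R d) * ((sqrt (norm y) *\<^sub>R d) * (sqrt (norm y) *\<^sub>R d)) = y * y"
      by (simp only:)
    show "(sqrt (norm y) *\<^sub>R d) * z = z * (sqrt (norm y) *\<^sub>R d)" if "y * z = z * y" for z
      using dc[of z] that by (simp add: y1_def)
  qed
qed

section \<open>The inner product of a faithful positive functional\<close>

locale faithful_positive_functional =
  fixes \<tau> :: "'a::unital_cstar_algebra \<Rightarrow> complex"
  assumes add: "\<tau> (x + y) = \<tau> x + \<tau> y"
    and scaleC: "\<tau> (c *\<^sub>C x) = c * \<tau> x"
    and pos: "\<tau> (star x * x) \<in> \<real>\<^sub>\<ge>\<^sub>0"
    and faithful: "\<tau> (star x * x) = 0 \<Longrightarrow> x = 0"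
begin

text \<open>
  The inner product of the GNS construction, restricted to its real part so that angles make sense.
\<close>

definition ip :: "'a \<Rightarrow> 'a \<Rightarrow> real" where
  "ip x y = Re (\<tau> (star x * y))"

lemma scaleR: "\<tau> (r *\<^sub>R x) = of_real r * \<tau> x"
  using scaleC[of "of_real r" x] by (simp add: scaleC_of_real)

lemma ip_add_left: "ip (x + y) z = ip x z + ip y z"
  by (simp add: ip_def star_add distrib_right add)

lemma ip_add_right: "ip x (y + z) = ip x y + ip x z"
  by (simp add: ip_def distrib_left add)

lemma ip_scaleR_left: "ip (r *\<^sub>R x) y = r * ip x y"
  by (simp add: ip_def star_scaleR scaleR)

lemma ip_scaleR_right: "ip x (r *\<^sub>R y) = r * ip x y"
  by (simp add: ip_def scaleR)

lemma ip_diff_left: "ip (x - y) z = ip x z - ip y z"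
  using ip_add_left[of x "(-1) *\<^sub>R y" z] ip_scaleR_left[of "-1" y z] by simp

lemma ip_diff_right: "ip x (y - z) = ip x y - ip x z"
  using ip_add_right[of x y "(-1) *\<^sub>R z"] ip_scaleR_right[of x "-1" z] by simp

lemma ip_zero [simp]: "ip x 0 = 0" "ip 0 x = 0"
  using ip_scaleR_right[of x 0 0] ip_scaleR_left[of 0 0 x] by simp_all

lemma ip_self_nonneg: "0 \<le> ip x x"
  using pos[of x] by (auto simp: ip_def nonneg_Reals_def)

lemma ip_self_eq_zero: "ip x x = 0 \<Longrightarrow> x = 0"
  using pos[of x] faithful[of x] by (auto simp: ip_def nonneg_Reals_def)

lemma ip_commute: "ip x y = ip y x"
proof -
  have "Im (\<tau> (star (x + \<i> *\<^sub>C y) * (x + \<i> *\<^sub>C y))) = 0"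
    "Im (\<tau> (star x * x)) = 0" "Im (\<tau> (star y * y)) = 0"
    using pos[of "x + \<i> *\<^sub>C y"] pos[of x] pos[of y] by (auto simp: nonneg_Reals_def)
  then show ?thesis
    by (simp add: ip_def star_add star_scaleC mult_scaleC_left mult_scaleC_right
        distrib_left distrib_right add scaleC)
qed

lemma ip_mult_left: "ip (a * x) y = ip x (star a * y)"
  by (simp add: ip_def star_mult mult.assoc)

lemma ip_Cauchy_Schwarz: "(ip x y)\<^sup>2 \<le> ip x x * ip y y"
proof (cases "y = 0")
  case False
  then have p: "ip y y > 0" using ip_self_nonneg[of y] ip_self_eq_zero[of y] by linarith
  let ?t = "ip x y / ip y y"
  have "0 \<le> ip (x - ?t *\<^sub>R y) (x - ?t *\<^sub>R y)" by (rule ip_self_nonneg)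
  also have "\<dots> = ip x x - (ip x y)\<^sup>2 / ip y y"
    using p by (simp add: ip_diff_left ip_diff_right ip_scaleR_left ip_scaleR_right ip_commute[of y x]
        power2_eq_square)
  finally show ?thesis using p by (simp add: field_simps)
qed simp

text \<open>
  For \<open>\<parallel>a\<parallel> = 1\<close>, the difference \<open>1 - a\<^sup>*a\<close> is the square of a self-adjoint element \<open>b\<close>, and
  \<open>\<langle>x,x\<rangle> - \<langle>ax,ax\<rangle> = \<langle>bx,bx\<rangle>\<close>.
\<close>

lemma ip_mult_self_le: "ip (a * x) (a * x) \<le> (norm a)\<^sup>2 * ip x x"
proof (cases "a = 0")
  case False
  define a1 where "a1 = (1 / norm a) *\<^sub>R a"
  have a: "a = norm a *\<^sub>R a1" and na1: "norm a1 = 1" using False by (simp_all add: a1_def)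
  have n: "norm (star a1 * a1) \<le> 1" by (simp add: cstar_identity na1)
  let ?b = "one_minus_power (1/2) (star a1 * a1)"
  have sb: "star ?b = ?b"
    by (rule star_one_minus_power_half[OF n]) (simp add: star_mult star_star)
  have "0 \<le> ip (?b * x) (?b * x)" by (rule ip_self_nonneg)
  also have "\<dots> = ip x ((?b * ?b) * x)" by (simp add: ip_mult_left sb mult.assoc)
  also have "\<dots> = ip x x - ip (a1 * x) (a1 * x)"
    unfolding one_minus_power_half_squared[OF n]
    by (simp add: left_diff_distrib ip_diff_right ip_mult_left mult.assoc)
  finally have "ip (a1 * x) (a1 * x) \<le> ip x x" by simp
  then have "(norm a)\<^sup>2 * ip (a1 * x) (a1 * x) \<le> (norm a)\<^sup>2 * ip x x"
    by (rule mult_left_mono) simp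
  moreover have "ip (a * x) (a * x) = (norm a)\<^sup>2 * ip (a1 * x) (a1 * x)"
    by (subst (1 2) a) (simp add: ip_scaleR_left ip_scaleR_right power2_eq_square)
  ultimately show ?thesis by simp
qed simp

lemma ip_unitary: "u \<in> unitary_group \<Longrightarrow> ip (u * x) (u * y) = ip x y"
  by (simp add: ip_mult_left unitary_group_cancel)

lemma bounded_linear_ip_mult: "bounded_linear (\<lambda>a. ip y (a * x))"
proof (rule bounded_linear_intro[where K = "sqrt (ip y y) * sqrt (ip x x)"])
  fix a :: 'a
  have "(ip y (a * x))\<^sup>2 \<le> ip y y * ((norm a)\<^sup>2 * ip x x)"
    by (rule order_trans[OF ip_Cauchy_Schwarz mult_left_mono[OF ip_mult_self_le ip_self_nonneg]])
  then have "\<bar>ip y (a * x)\<bar> \<le> sqrt (ip y y * ((norm a)\<^sup>2 * ip x x))"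
    using real_le_rsqrt[of "\<bar>ip y (a * x)\<bar>"] by simp
  then show "norm (ip y (a * x)) \<le> norm a * (sqrt (ip y y) * sqrt (ip x x))"
    by (simp add: real_sqrt_mult mult_ac)
qed (simp_all add: distrib_right ip_add_right ip_scaleR_right)

text \<open>
  Uniqueness of the positive square root, where \<open>y\<close> is positive only in the sense of the inner
  product. The difference \<open>d = c\<^sup>2 - y\<close> is annihilated by \<open>c\<^sup>2 + y\<close>; both summands are nonnegative on
  the vector \<open>d\<close>, so each vanishes there, and then \<open>d\<^sup>2 = 0\<close>.
\<close>

lemma eq_square_if_squares_eq:
  assumes y: "star y = y" "\<And>x. 0 \<le> ip x (y * x)"
    and c: "star c = c" "(c * c) * (c * c) = y * y" "c * y = y * c"
  shows "y = c * c"
proof -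
  define d where "d = c * c - y"
  have sd: "star d = d" by (simp add: d_def star_diff star_mult y c)
  have ky: "c * c * y = y * (c * c)" using c(3) by (metis mult.assoc)
  have z: "y * d + c * c * d = 0"
    unfolding d_def using c(2) ky by (simp add: right_diff_distrib)
  have "ip d (c * c * d) = ip (c * d) (c * d)" by (simp add: ip_mult_left c mult.assoc)
  moreover have "ip d (y * d) + ip d (c * c * d) = 0"
    by (simp add: z flip: ip_add_right)
  ultimately have "ip (c * d) (c * d) = 0"
    using y(2)[of d] ip_self_nonneg[of "c * d"] by linarith
  then have "c * d = 0" by (rule ip_self_eq_zero)
  then have kd: "c * c * d = 0" by (simp add: mult.assoc)
  then have "y * d = 0" using z by simp
  then have "d * d = 0" using kd by (simp add: d_def left_diff_distrib)
  then have "d = 0" by (rule eq_zero_if_self_adjoint_square_zero[OF sd])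
  then show ?thesis by (simp add: d_def)
qed

text \<open>
  By uniqueness of the positive root \<open>1 - h\<^sup>2 = \<bar>1 - h\<^sup>2\<bar> = c\<^sup>2\<close>, so \<open>h\<close> is the real part of the unitary
  \<open>h + ic\<close>.
\<close>

lemma norm_le_if_contraction:
  assumes h: "star h = h" "\<And>x. ip (h * x) (h * x) \<le> ip x x"
  shows "norm h \<le> 1"
proof -
  let ?y = "1 - h * h"
  have sy: "star ?y = ?y" by (simp add: star_diff star_mult h)
  obtain c where c: "star c = c" "(c * c) * (c * c) = ?y * ?y"
    "\<And>z. ?y * z = z * ?y \<Longrightarrow> c * z = z * c"
    using self_adjoint_sqrt_abs[OF sy] by blast
  have "?y = c * c"
  proof (rule eq_square_if_squares_eq[OF sy _ c(1,2)])
    show "0 \<le> ip x (?y * x)" for x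
      using h(2)[of x] by (simp add: left_diff_distrib ip_diff_right ip_mult_left h mult.assoc)
    show "c * ?y = ?y * c" by (rule c(3)) simp
  qed
  moreover have ch: "c * h = h * c"
    by (rule c(3)) (simp add: algebra_simps)
  ultimately have "h + \<i> *\<^sub>C c \<in> unitary_group"
    by (intro unitary_add_i_mult h c) (simp_all add: ch flip: \<open>?y = c * c\<close>)
  then have "norm (h + \<i> *\<^sub>C c) = 1" by (rule norm_unitary)
  then show ?thesis
    using norm_re_part_le[of "h + \<i> *\<^sub>C c"] re_im_part_eqI[OF h(1) c(1) refl] by simp
qed

lemma norm_le_if_ip_mult_self_le:
  assumes h: "star h = h" "\<And>x. ip (h * x) (h * x) \<le> r\<^sup>2 * ip x x" and r: "0 \<le> r"
  shows "norm h \<le> r"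
proof (cases "r = 0")
  case True
  have "ip h h \<le> 0" using h(2)[of 1] True by simp
  then have "ip h h = 0" using ip_self_nonneg[of h] by linarith
  then show ?thesis using ip_self_eq_zero True by simp
next
  case False
  then have r: "r > 0" using r by simp
  have "norm ((1 / r) *\<^sub>R h) \<le> 1"
  proof (rule norm_le_if_contraction)
    show "star ((1 / r) *\<^sub>R h) = (1 / r) *\<^sub>R h" by (simp add: star_scaleR h)
    show "ip ((1 / r) *\<^sub>R h * x) ((1 / r) *\<^sub>R h * x) \<le> ip x x" for x
      using h(2)[of x] r by (simp add: ip_scaleR_left ip_scaleR_right power2_eq_square field_simps)
  qed
  then show ?thesis using r by (simp add: field_simps)
qed

end

section \<open>Lengths of curves\<close>

text \<open>
  To compare a length with the increment of a function \<open>G\<close> it suffices to do so on each piece.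
  The derivative in the definition of the length is taken within the whole interval; it agrees with
  the derivative of the piece except at the break points, which do not affect the integral.
\<close>

lemma diff_le_curve_length:
  fixes \<gamma> :: "real \<Rightarrow> 'a::real_normed_vector" and G :: "real \<Rightarrow> real"
  assumes "piecewise_smooth_curve_on a b \<gamma>"
    and step: "\<And>p q \<gamma>'. a \<le> p \<Longrightarrow> p < q \<Longrightarrow> q \<le> b \<Longrightarrow> continuous_on {p..q} \<gamma>' \<Longrightarrow>
      (\<And>t. t \<in> {p..q} \<Longrightarrow> (\<gamma> has_vector_derivative \<gamma>' t) (at t within {p..q})) \<Longrightarrow>
      G q - G p \<le> integral {p..q} (\<lambda>t. norm (\<gamma>' t))"
  shows "G b - G a \<le> curve_length a b \<gamma>"
proof -
  obtain n P where P: "P 0 = a" "P n = b"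
    and P_less: "\<And>i. i < n \<Longrightarrow> P i < P (Suc i)"
    and smooth: "\<And>i. i < n \<Longrightarrow> smooth_curve_on (P i) (P (Suc i)) \<gamma>"
    using assms(1) unfolding piecewise_smooth_curve_on_def by blast
  define N where "N t = norm (vector_derivative \<gamma> (at t within {a..b}))" for t
  have P_mono: "P i \<le> P j" if "i \<le> j" "j \<le> n" for i j
    using that
  proof (induction j rule: dec_induct)
    case (step j)
    then show ?case using P_less[of j] by simp
  qed simp
  have "N integrable_on {a..P k} \<and> G (P k) - G a \<le> integral {a..P k} N" if "k \<le> n" for k
    using that
  proof (induction k)
    case 0
    show ?case using integrable_on_refl[of N a] by (simp add: P)
  next
    case (Suc k)
    let ?p = "P k" and ?q = "P (Suc k)"
    have ineq: "a \<le> ?p" "?p < ?q" "?q \<le> b"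
      using P_mono[of 0 k] P_mono[of "Suc k" n] P_less[of k] P Suc.prems by auto
    obtain \<gamma>' where \<gamma>': "continuous_on {?p..?q} \<gamma>'"
      "\<And>t. t \<in> {?p..?q} \<Longrightarrow> (\<gamma> has_vector_derivative \<gamma>' t) (at t within {?p..?q})"
      using smooth[of k] Suc.prems unfolding smooth_curve_on_def by auto
    have N: "N t = norm (\<gamma>' t)" if t: "t \<in> {?p..?q} - {?p, ?q}" for t
    proof -
      have "at t within {?p..?q} = at t" "at t within {a..b} = at t"
        using t ineq by (auto intro!: at_within_Icc_at)
      then have "vector_derivative \<gamma> (at t within {a..b}) = \<gamma>' t"
        using \<gamma>'(2)[of t] t by (auto intro!: vector_derivative_at)
      then show ?thesis by (simp add: N_def)
    qed
    have "(\<lambda>t. norm (\<gamma>' t)) integrable_on {?p..?q}"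
      by (intro integrable_continuous_real continuous_on_norm \<gamma>')
    then have int: "N integrable_on {?p..?q}"
      by (rule integrable_spike_finite[of "{?p, ?q}", rotated 2]) (use N in auto)
    have "integral {?p..?q} N = integral {?p..?q} (\<lambda>t. norm (\<gamma>' t))"
      by (rule integral_spike[of "{?p, ?q}"]) (use N in auto)
    moreover have "G ?q - G ?p \<le> integral {?p..?q} (\<lambda>t. norm (\<gamma>' t))"
      by (rule step) (use ineq \<gamma>' in auto)
    moreover have IH: "N integrable_on {a..?p}" "G ?p - G a \<le> integral {a..?p} N"
      using Suc by auto
    moreover have full: "N integrable_on {a..?q}"
      using Henstock_Kurzweil_Integration.integrable_combine[of a ?p ?q N] ineq int IH by simp
    moreover have "integral {a..?p} N + integral {?p..?q} N = integral {a..?q} N"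
      using Henstock_Kurzweil_Integration.integral_combine[of a ?p ?q N] ineq full by simp
    ultimately show ?case by simp
  qed
  from this[of n] P show ?thesis by (simp add: curve_length_def N_def[abs_def])
qed

lemma curve_length_nonneg:
  assumes "piecewise_smooth_curve_on a b \<gamma>"
  shows "0 \<le> curve_length a b \<gamma>"
  using diff_le_curve_length[OF assms, of "\<lambda>_. 0"]
  by (simp add: integral_nonneg integrable_continuous_real continuous_on_norm)

lemma curve_length_smooth:
  assumes "a < b" "\<And>t. t \<in> {a..b} \<Longrightarrow> (\<gamma> has_vector_derivative \<gamma>' t) (at t within {a..b})"
  shows "curve_length a b \<gamma> = integral {a..b} (\<lambda>t. norm (\<gamma>' t))"
  unfolding curve_length_def
proof (rule integral_cong)
  show "norm (vector_derivative \<gamma> (at t within {a..b})) = norm (\<gamma>' t)" if "t \<in> {a..b}" for t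
    using vector_derivative_within_cbox[of a b t \<gamma> "\<gamma>' t"] assms that by simp
qed

lemma d_infty_le_curve_length:
  assumes "piecewise_smooth_curve_on a b \<gamma>" "\<And>t. t \<in> {a..b} \<Longrightarrow> \<gamma> t \<in> unitary_group"
  shows "d_infty (\<gamma> a) (\<gamma> b) \<le> ereal (curve_length a b \<gamma>)"
  unfolding d_infty_def by (rule Inf_lower) (use assms in blast)

lemma d_infty_nonneg: "0 \<le> d_infty u w"
  unfolding d_infty_def by (rule Inf_greatest) (auto simp: curve_length_nonneg)

text \<open>
  The constant curve has vanishing derivative and does not qualify, and there may be no short smooth
  loop either. Instead run along \<open>e\<^sup>i\<^sup>\<theta>u\<close> for a short while and back again.
\<close>

lemma d_infty_refl:
  fixes u :: "'a::unital_cstar_algebra"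
  assumes u: "u \<in> unitary_group"
  shows "d_infty u u = 0"
proof -
  have le: "d_infty u u \<le> ereal (2 * e)" if e: "e > 0" for e
  proof -
    \<comment> \<open>The phase is shifted by \<open>-e\<close> so that the loop is based at \<open>u\<close>; it turns back at \<open>t = 0\<close>.\<close>
    define \<gamma> where "\<gamma> t = cis (e * \<bar>t\<bar> - e) *\<^sub>C u" for t :: real
    \<comment> \<open>The derivative of \<open>\<gamma>\<close> on the half-line of sign \<open>\<sigma>\<close>.\<close>
    define D where "D \<sigma> t = (of_real (\<sigma> * e) * \<i> * cis (\<sigma> * e * t - e)) *\<^sub>C u" for \<sigma> t :: real
    have der: "(\<gamma> has_vector_derivative D \<sigma> t) (at t within S)"
      if "t \<in> S" "\<And>s. s \<in> S \<Longrightarrow> \<bar>s\<bar> = \<sigma> * s" for S \<sigma> t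
    proof -
      have "((\<lambda>t. cis (\<sigma> * e * t - e)) has_vector_derivative of_real (\<sigma> * e) * \<i> * cis (\<sigma> * e * t - e)) (at t within S)"
        unfolding has_vector_derivative_def
        by (auto intro!: derivative_eq_intros simp: scaleR_conv_of_real mult_ac)
      then have "((\<lambda>t. cis (\<sigma> * e * t - e) *\<^sub>C u) has_vector_derivative D \<sigma> t) (at t within S)"
        unfolding D_def by (rule bounded_linear.has_vector_derivative[OF bounded_linear_scaleC_left])
      then show ?thesis
        by (rule has_vector_derivative_transform[OF that(1), rotated])
           (use that(2) in \<open>auto simp: \<gamma>_def mult_ac\<close>)
    qed
    have normD: "norm (D \<sigma> t) = e" if "\<bar>\<sigma>\<bar> = 1" for \<sigma> t
      using that e by (simp add: D_def norm_scaleC norm_mult norm_unitary[OF u] abs_mult)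
    have contD: "continuous_on S (D \<sigma>)" for S \<sigma>
      unfolding D_def
      by (intro bounded_linear.continuous_on[OF bounded_linear_scaleC_left] continuous_intros)
    have smooth: "smooth_curve_on p q \<gamma>" if "\<bar>\<sigma>\<bar> = 1" "\<And>s. s \<in> {p..q} \<Longrightarrow> \<bar>s\<bar> = \<sigma> * s" for p q \<sigma>
      unfolding smooth_curve_on_def
      by (rule exI[of _ "D \<sigma>"]) (use der[of _ "{p..q}" \<sigma>] contD normD[OF that(1)] that e in force)
    have "piecewise_smooth_curve_on (-1) 1 \<gamma>"
      unfolding piecewise_smooth_curve_on_def
    proof (intro conjI exI[of _ 2] exI[of _ "\<lambda>i. real i - 1"])
      show "\<forall>i<2. real i - 1 < real (Suc i) - 1 \<and> smooth_curve_on (real i - 1) (real (Suc i) - 1) \<gamma>"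
        using smooth[of "-1" "-1" 0] smooth[of 1 0 1] by (auto simp: less_2_cases_iff)
    qed simp_all
    moreover have "\<gamma> t \<in> unitary_group" for t
      using unitary_groupD[OF u]
      by (simp add: \<gamma>_def unitary_group_def star_scaleC mult_scaleC_left mult_scaleC_right
          scaleC_scaleC cis_cnj cis_mult)
    moreover have "curve_length (-1) 1 \<gamma> = integral {-1..1::real} (\<lambda>_. e)"
      unfolding curve_length_def
    proof (rule integral_spike[of "{-1, 0, 1}"])
      fix t :: real assume t: "t \<in> {-1..1} - {-1, 0, 1}"
      then have at: "at t within {-1..1} = at t" by (auto intro!: at_within_Icc_at)
      have "\<exists>S. open S \<and> t \<in> S \<and> (\<forall>s\<in>S. \<bar>s\<bar> = sgn t * s)"
        by (rule exI[of _ "if t > 0 then {0<..} else {..<0}"]) (use t in auto)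
      then obtain S where S: "t \<in> S" "open S" "\<And>s. s \<in> S \<Longrightarrow> \<bar>s\<bar> = sgn t * s" by blast
      have "(\<gamma> has_vector_derivative D (sgn t) t) (at t)"
        using der[OF S(1,3)] unfolding at_within_open[OF S(1,2)] by blast
      then have "vector_derivative \<gamma> (at t) = D (sgn t) t"
        by (rule vector_derivative_at)
      moreover have "\<bar>sgn t\<bar> = 1" using t by (simp add: abs_sgn_eq)
      ultimately show "e = norm (vector_derivative \<gamma> (at t within {-1..1}))"
        by (simp only: at normD)
    qed simp
    ultimately have "d_infty (\<gamma> (-1)) (\<gamma> 1) \<le> ereal (integral {-1..1::real} (\<lambda>_. e))"
      using d_infty_le_curve_length[of "-1" 1 \<gamma>] by simp
    then show ?thesis by (simp add: \<gamma>_def)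
  qed
  have "d_infty u u \<le> ereal 0 + ereal e" if "e > 0" for e
    using le[of "e / 2"] that by simp
  then have "d_infty u u \<le> ereal 0"
    using ereal_le_epsilon2 by blast
  then show ?thesis
    using d_infty_nonneg[of u u] by (simp add: zero_ereal_def antisym)
qed

section \<open>Curves of unitaries turn vectors slowly\<close>

context faithful_positive_functional
begin

text \<open>
  The vector \<open>Dx\<close> is tangent to the sphere at \<open>\<gamma>(t)x\<close>. It therefore only sees the component of \<open>ux\<close>
  orthogonal to \<open>\<gamma>(t)x\<close>, whose length is the sine of the angle between the two.
\<close>

lemma abs_ip_derivative_le:
  assumes unit: "\<And>t. t \<in> {p..q} \<Longrightarrow> \<gamma> t \<in> unitary_group" and "p < q" and t: "t \<in> {p..q}"
    and der: "(\<gamma> has_vector_derivative D) (at t within {p..q})"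
    and u: "u \<in> unitary_group" and N: "ip x x = 1"
  shows "\<bar>ip (u * x) (D * x)\<bar> \<le> norm D * sqrt (1 - (ip (u * x) (\<gamma> t * x))\<^sup>2)"
proof -
  note g = unit[OF t]
  let ?f = "ip (u * x) (\<gamma> t * x)"
  have tangent: "ip (\<gamma> t * x) (D * x) = 0"
  proof -
    have "((\<lambda>t. star (\<gamma> t) * \<gamma> t) has_vector_derivative star (\<gamma> t) * D + star D * \<gamma> t) (at t within {p..q})"
      by (intro has_vector_derivative_mult der bounded_linear.has_vector_derivative[OF bounded_linear_star])
    moreover have "((\<lambda>t. star (\<gamma> t) * \<gamma> t) has_vector_derivative 0) (at t within {p..q})"
      by (rule has_vector_derivative_transform[OF t _ has_vector_derivative_const[of 1]])
         (simp add: unit unitary_groupD)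
    ultimately have "star (\<gamma> t) * D + star D * \<gamma> t = 0"
      using vector_derivative_unique_within_closed_interval[of p q t] assms(2) t by auto
    then have "ip x ((star (\<gamma> t) * D + star D * \<gamma> t) * x) = 0" by simp
    then have "ip (\<gamma> t * x) (D * x) + ip (D * x) (\<gamma> t * x) = 0"
      by (simp add: distrib_right ip_add_right ip_mult_left mult.assoc)
    then show ?thesis using ip_commute[of "D * x" "\<gamma> t * x"] by simp
  qed
  let ?e = "u * x - ?f *\<^sub>R (\<gamma> t * x)"
  have "ip (u * x) (D * x) = ip ?e (D * x)"
    by (simp add: ip_diff_left ip_scaleR_left tangent)
  also have "\<bar>\<dots>\<bar> \<le> sqrt (ip ?e ?e * ip (D * x) (D * x))"
    using ip_Cauchy_Schwarz[of ?e "D * x"] real_le_rsqrt[of "\<bar>ip ?e (D * x)\<bar>"] by simp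
  also have "\<dots> \<le> sqrt (ip ?e ?e * (norm D)\<^sup>2)"
    using ip_mult_self_le[of D x] ip_self_nonneg[of ?e] N by (intro real_sqrt_le_mono mult_left_mono) auto
  also have "ip ?e ?e = 1 - ?f\<^sup>2"
    using ip_unitary[OF u, of x x] ip_unitary[OF g, of x x] N ip_commute[of "\<gamma> t * x" "u * x"]
    by (simp add: ip_diff_left ip_diff_right ip_scaleR_left ip_scaleR_right power2_eq_square)
  also have "sqrt ((1 - ?f\<^sup>2) * (norm D)\<^sup>2) = norm D * sqrt (1 - ?f\<^sup>2)"
    by (simp add: real_sqrt_mult)
  finally show ?thesis .
qed

lemma ip_unitary_abs_le_1:
  assumes "u \<in> unitary_group" "w \<in> unitary_group" "ip x x = 1"
  shows "\<bar>ip (u * x) (w * x)\<bar> \<le> 1"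
  using ip_Cauchy_Schwarz[of "u * x" "w * x"] assms
  by (simp add: ip_unitary abs_square_le_1)

text \<open>
  With \<open>f(t) = \<langle>ux, \<gamma>(t)x\<rangle>\<close>, the function \<open>arcsin f\<close> is the complement of the angle between \<open>ux\<close> and
  \<open>\<gamma>(t)x\<close>, but it is not differentiable where \<open>f = \<plusminus>1\<close>. The factor \<open>c < 1\<close> removes these
  singularities and keeps the Lipschitz estimate, as \<open>c (1 - f\<^sup>2)\<^sup>1\<^sup>/\<^sup>2 \<le> (1 - c\<^sup>2f\<^sup>2)\<^sup>1\<^sup>/\<^sup>2\<close>.
\<close>

lemma arcsin_diff_le_curve_length:
  assumes curve: "piecewise_smooth_curve_on a b \<gamma>"
    and unit: "\<And>t. t \<in> {a..b} \<Longrightarrow> \<gamma> t \<in> unitary_group"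
    and u: "u \<in> unitary_group" and N: "ip x x = 1" and c: "0 \<le> c" "c < 1"
  shows "arcsin (c * ip (u * x) (\<gamma> a * x)) - arcsin (c * ip (u * x) (\<gamma> b * x)) \<le> curve_length a b \<gamma>"
proof -
  define f where "f t = ip (u * x) (\<gamma> t * x)" for t
  have "- arcsin (c * f b) - (- arcsin (c * f a)) \<le> curve_length a b \<gamma>"
  proof (rule diff_le_curve_length[OF curve])
    fix p q \<gamma>'
    assume pq: "a \<le> p" "p < q" "q \<le> b" and cont: "continuous_on {p..q} \<gamma>'"
      and der: "\<And>t. t \<in> {p..q} \<Longrightarrow> (\<gamma> has_vector_derivative \<gamma>' t) (at t within {p..q})"
    have unit': "\<gamma> t \<in> unitary_group" if "t \<in> {p..q}" for t using unit[of t] that pq by auto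
    define f' where "f' t = ip (u * x) (\<gamma>' t * x)" for t
    let ?G' = "\<lambda>t. - (c * f' t / sqrt (1 - (c * f t)\<^sup>2))"
    have cf: "\<bar>c * f t\<bar> < 1" if "t \<in> {p..q}" for t
      using ip_unitary_abs_le_1[OF u unit'[OF that] N] c mult_left_le[of "\<bar>f t\<bar>" c]
      by (simp add: f_def abs_mult)
    have derG: "((\<lambda>t. - arcsin (c * f t)) has_vector_derivative ?G' t) (at t within {p..q})"
      if t: "t \<in> {p..q}" for t
    proof -
      have "(f has_vector_derivative f' t) (at t within {p..q})"
        unfolding f_def f'_def
        by (rule bounded_linear.has_vector_derivative[OF bounded_linear_ip_mult der[OF t]])
      then have f: "(f has_field_derivative f' t) (at t within {p..q})"
        by (simp add: has_real_derivative_iff_has_vector_derivative)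
      have "((\<lambda>t. - arcsin (c * f t)) has_field_derivative ?G' t) (at t within {p..q})"
        using cf[OF t] by (auto intro!: derivative_eq_intros f simp: abs_less_iff divide_simps)
      then show ?thesis
        by (simp add: has_real_derivative_iff_has_vector_derivative)
    qed
    have G: "(?G' has_integral (- arcsin (c * f q) - (- arcsin (c * f p)))) {p..q}"
      by (rule fundamental_theorem_of_calculus) (use pq derG in auto)
    have "(\<lambda>t. norm (\<gamma>' t)) integrable_on {p..q}"
      by (intro integrable_continuous_real continuous_on_norm cont)
    then show "- arcsin (c * f q) - (- arcsin (c * f p)) \<le> integral {p..q} (\<lambda>t. norm (\<gamma>' t))"
    proof (rule has_integral_le[OF G integrable_integral])
      fix t assume t: "t \<in> {p..q}"
      have f1: "(f t)\<^sup>2 \<le> 1"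
        using ip_unitary_abs_le_1[OF u unit'[OF t] N] by (simp add: f_def abs_square_le_1)
      have pos: "0 < 1 - (c * f t)\<^sup>2"
        using cf[OF t] by (simp add: abs_square_less_1)
      have "c * sqrt (1 - (f t)\<^sup>2) = sqrt (c\<^sup>2 * (1 - (f t)\<^sup>2))"
        using c by (simp add: real_sqrt_mult)
      also have "\<dots> \<le> sqrt (1 - (c * f t)\<^sup>2)"
        using c by (intro real_sqrt_le_mono) (simp add: power_mult_distrib algebra_simps power_le_one)
      finally have s: "c * sqrt (1 - (f t)\<^sup>2) \<le> sqrt (1 - (c * f t)\<^sup>2)" .
      have "\<bar>f' t\<bar> \<le> norm (\<gamma>' t) * sqrt (1 - (f t)\<^sup>2)"
        unfolding f_def f'_def
        by (rule abs_ip_derivative_le[OF unit' pq(2) t der[OF t] u N])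
      then have "c * \<bar>f' t\<bar> \<le> norm (\<gamma>' t) * (c * sqrt (1 - (f t)\<^sup>2))"
        using c by (metis mult.left_commute mult_left_mono)
      also have "\<dots> \<le> norm (\<gamma>' t) * sqrt (1 - (c * f t)\<^sup>2)"
        using s by (rule mult_left_mono) simp
      finally have "c * \<bar>f' t\<bar> / sqrt (1 - (c * f t)\<^sup>2) \<le> norm (\<gamma>' t)"
        using pos by (simp add: divide_le_eq)
      moreover have "?G' t \<le> c * \<bar>f' t\<bar> / sqrt (1 - (c * f t)\<^sup>2)"
      proof -
        have "- (c * f' t) \<le> c * \<bar>f' t\<bar>" using c mult_left_mono[of "- f' t" "\<bar>f' t\<bar>" c] by simp
        then show ?thesis using pos divide_right_mono[of "- (c * f' t)" "c * \<bar>f' t\<bar>" "sqrt (1 - (c * f t)\<^sup>2)"] by simp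
      qed
      ultimately show "?G' t \<le> norm (\<gamma>' t)" by linarith
    qed
  qed
  then show ?thesis by (simp add: f_def)
qed

text \<open>
  For a unit vector the statement is the limit \<open>c \<rightarrow> 1\<close> of the previous one with \<open>u = \<gamma>(a)\<close>, where
  \<open>f(a) = 1\<close>.
\<close>

lemma cos_curve_length_le_ip:
  assumes curve: "piecewise_smooth_curve_on a b \<gamma>"
    and unit: "\<And>t. t \<in> {a..b} \<Longrightarrow> \<gamma> t \<in> unitary_group"
    and L: "curve_length a b \<gamma> \<le> pi"
  shows "cos (curve_length a b \<gamma>) * ip x x \<le> ip (\<gamma> a * x) (\<gamma> b * x)"
proof (cases "x = 0")
  case False
  let ?L = "curve_length a b \<gamma>"
  have ab: "a < b" using curve by (simp add: piecewise_smooth_curve_on_def)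
  have a: "\<gamma> a \<in> unitary_group" and b: "\<gamma> b \<in> unitary_group" using unit ab by auto
  have n: "ip x x > 0" using ip_self_eq_zero[of x] ip_self_nonneg[of x] False by linarith
  define y where "y = (1 / sqrt (ip x x)) *\<^sub>R x"
  have N: "ip y y = 1" using n by (simp add: y_def ip_scaleR_left ip_scaleR_right)
  define fb where "fb = ip (\<gamma> a * y) (\<gamma> b * y)"
  have fb: "\<bar>fb\<bar> \<le> 1" unfolding fb_def by (rule ip_unitary_abs_le_1[OF a b N])
  have fa: "ip (\<gamma> a * y) (\<gamma> a * y) = 1" by (simp add: ip_unitary a N)
  have "arcsin (1 * 1) - arcsin (1 * fb) \<le> ?L"
  proof (rule continuous_le_on_closure[where S = "{0..<1}" and f = "\<lambda>c. arcsin (c * 1) - arcsin (c * fb)"])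
    have "\<bar>c * fb\<bar> \<le> 1" if "0 \<le> c" "c \<le> 1" for c
      using that fb mult_mono[of c 1 "\<bar>fb\<bar>" 1] by (simp add: abs_mult)
    then show "continuous_on (closure {0..<1}) (\<lambda>c. arcsin (c * 1) - arcsin (c * fb))"
      by (intro continuous_intros) (auto simp: abs_le_iff)
    show "1 \<in> closure {0..<1::real}" by simp
    show "arcsin (c * 1) - arcsin (c * fb) \<le> ?L" if "c \<in> {0..<1}" for c
      using arcsin_diff_le_curve_length[OF curve unit a N, of c] that by (simp add: fa fb_def)
  qed
  then have "pi / 2 - ?L \<le> arcsin fb" by simp
  then have "sin (pi / 2 - ?L) \<le> sin (arcsin fb)"
    using L fb arcsin_bounded[of fb] by (intro sin_monotone_2pi_le) auto
  then have "cos ?L \<le> fb" using fb by (simp add: sin_diff)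
  moreover have "ip (\<gamma> a * x) (\<gamma> b * x) = ip x x * fb"
    using n by (simp add: fb_def y_def ip_scaleR_left ip_scaleR_right)
  ultimately show ?thesis
    using n by (simp add: mult.commute)
qed simp

end

section \<open>Distance as an angle\<close>

lemma star_exp: "star (exp x) = exp (star (x::'a::unital_cstar_algebra))"
  unfolding exp_def bounded_linear.suminf[OF bounded_linear_star summable_exp_generic]
  by (simp add: star_scaleR star_power)

lemma exp_unitary: "star z = - z \<Longrightarrow> exp z \<in> unitary_group"
  using exp_minus_inverse[of z] exp_minus_inverse[of "- z"] by (simp add: unitary_group_def star_exp)

context faithful_positive_functional
begin

lemma ip_re_part: "ip x (re_part a * x) = ip x (a * x)"
proof -
  have "ip x (star a * x) = ip x (a * x)"
    using ip_mult_left[of a x x] ip_commute[of x "a * x"] by simp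
  then show ?thesis by (simp add: re_part_def ip_scaleR_right ip_add_right distrib_right)
qed

lemma ip_re_part_im_part_self:
  assumes "v \<in> unitary_group"
  shows "ip (re_part v * x) (re_part v * x) + ip (im_part v * x) (im_part v * x) = ip x x"
  using unitary_re_im_part(2)[OF assms]
  by (simp add: ip_mult_left flip: mult.assoc ip_add_right distrib_right)

text \<open>
  If \<open>v\<close> turns no vector by more than \<open>r\<close>, then \<open>(Re v)\<^sup>2\<close> is at least \<open>cos\<^sup>2 r\<close>, by the Cauchy-Schwarz
  inequality, and \<open>(Im v)\<^sup>2 = 1 - (Re v)\<^sup>2\<close> is at most \<open>sin\<^sup>2 r\<close>.
\<close>

lemma norm_im_part_le_sin:
  assumes v: "v \<in> unitary_group" and r: "0 \<le> r" "r \<le> pi / 2"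
    and le: "\<And>x. cos r * ip x x \<le> ip x (v * x)"
  shows "norm (im_part v) \<le> sin r"
proof (rule norm_le_if_ip_mult_self_le)
  show "0 \<le> sin r" using r by (intro sin_ge_zero) auto
  show "ip (im_part v * x) (im_part v * x) \<le> (sin r)\<^sup>2 * ip x x" for x
  proof (cases "x = 0")
    case False
    then have n: "ip x x > 0" using ip_self_eq_zero[of x] ip_self_nonneg[of x] by linarith
    have "0 \<le> cos r * ip x x" using r n by (intro mult_nonneg_nonneg cos_ge_zero) auto
    then have "(cos r * ip x x)\<^sup>2 \<le> (ip x (re_part v * x))\<^sup>2"
      using le[of x] by (simp add: ip_re_part power_mono)
    also have "\<dots> \<le> ip x x * ip (re_part v * x) (re_part v * x)"
      by (rule ip_Cauchy_Schwarz)
    finally have "(cos r)\<^sup>2 * ip x x \<le> ip (re_part v * x) (re_part v * x)"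
      using n by (simp add: power2_eq_square mult_ac)
    then show ?thesis
      using ip_re_part_im_part_self[OF v, of x] by (simp add: sin_squared_eq algebra_simps)
  qed simp
qed simp

text \<open>
  The same bound when \<open>v\<^sup>2\<close> turns no vector by more than \<open>2r\<close>: \<open>Re v\<^sup>2 = 1 - 2 (Im v)\<^sup>2\<close> is the operator
  form of \<open>cos 2r = 1 - 2 sin\<^sup>2 r\<close>. This is where squaring doubles angles.
\<close>

lemma norm_im_part_le_sin_if_square:
  assumes v: "v \<in> unitary_group" and r: "0 \<le> r" "r \<le> pi / 2"
    and le: "\<And>x. cos (2 * r) * ip x x \<le> ip x (v * v * x)"
  shows "norm (im_part v) \<le> sin r"
proof (rule norm_le_if_ip_mult_self_le)
  show "0 \<le> sin r" using r by (intro sin_ge_zero) auto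
  let ?h = "re_part v" and ?k = "im_part v"
  note hk = unitary_re_im_part[OF v]
  have kk: "(\<i> *\<^sub>C ?k) * (\<i> *\<^sub>C ?k) = - (?k * ?k)"
    using scaleC_of_real[of "-1" "?k * ?k"] by (simp add: mult_scaleC_left mult_scaleC_right scaleC_scaleC)
  have "v * v = (?h + \<i> *\<^sub>C ?k) * (?h + \<i> *\<^sub>C ?k)"
    by (simp flip: re_part_add_im_part)
  also have "\<dots> = (?h * ?h - ?k * ?k) + \<i> *\<^sub>C (2 *\<^sub>R (?h * ?k))"
    using kk by (simp add: distrib_left distrib_right mult_scaleC_left mult_scaleC_right hk
        scaleR_2 scaleC_add_right)
  finally have "re_part (v * v) = ?h * ?h - ?k * ?k"
    by (intro re_im_part_eqI(1)) (simp_all add: star_diff star_mult star_scaleR hk)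
  then have "ip x (v * v * x) = ip (?h * x) (?h * x) - ip (?k * x) (?k * x)" for x
    unfolding ip_re_part[of x "v * v", symmetric]
    by (simp add: ip_mult_left left_diff_distrib ip_diff_right mult.assoc)
  then show "ip (im_part v * x) (im_part v * x) \<le> (sin r)\<^sup>2 * ip x x" for x
    using le[of x] ip_re_part_im_part_self[OF v, of x]
    unfolding cos_double_sin by (simp add: left_diff_distrib)
qed simp

text \<open>
  Curves from \<open>u\<close> to \<open>w\<close> of length close to the distance \<open>r\<close> show that \<open>u\<^sup>*w\<close> turns no vector by more
  than \<open>r\<close>.
\<close>

lemma d_infty_lower_bound:
  assumes u: "u \<in> unitary_group" and w: "w \<in> unitary_group"
    and less: "d_infty u w < ereal (pi / 2)"
  obtains r where "d_infty u w = ereal r" "0 \<le> r" "r < pi / 2"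
    "\<And>x. cos r * ip x x \<le> ip x (star u * w * x)"
proof -
  obtain r where r: "d_infty u w = ereal r"
    using less d_infty_nonneg[of u w] by (cases "d_infty u w") auto
  have r0: "0 \<le> r" "r < pi / 2"
    using less d_infty_nonneg[of u w] unfolding r by simp_all
  have "cos r * ip x x \<le> ip x (star u * w * x)" for x
  proof (rule continuous_le_on_closure[where S = "{r<..<pi/2}" and f = "\<lambda>t. cos t * ip x x"])
    fix e assume e: "e \<in> {r<..<pi/2}"
    then have "d_infty u w < ereal e" using r by simp
    then obtain a b \<gamma> where curve: "piecewise_smooth_curve_on a b \<gamma>"
      and unit: "\<And>t. t \<in> {a..b} \<Longrightarrow> \<gamma> t \<in> unitary_group" and ends: "\<gamma> a = u" "\<gamma> b = w"
      and L: "curve_length a b \<gamma> < e"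
      unfolding d_infty_def Inf_less_iff by auto
    have "cos e \<le> cos (curve_length a b \<gamma>)"
      using L e curve_length_nonneg[OF curve] by (intro cos_monotone_0_pi_le) auto
    then have "cos e * ip x x \<le> cos (curve_length a b \<gamma>) * ip x x"
      by (rule mult_right_mono[OF _ ip_self_nonneg])
    also have "\<dots> \<le> ip (u * x) (w * x)"
    proof -
      have "e < pi / 2" using e by simp
      then have "curve_length a b \<gamma> \<le> pi" using L pi_gt_zero by linarith
      then show ?thesis using cos_curve_length_le_ip[OF curve unit, of x] ends by simp
    qed
    also have "\<dots> = ip x (star u * w * x)"
      by (simp add: ip_mult_left mult.assoc)
    finally show "cos e * ip x x \<le> ip x (star u * w * x)" .
  qed (use r0 in \<open>auto intro!: continuous_intros\<close>)
  with r r0 show ?thesis using that by blast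
qed

text \<open>
  Write \<open>y = Im v\<close>, \<open>b(t) = (1 - t\<^sup>2y\<^sup>2)\<^sup>1\<^sup>/\<^sup>2\<close>, \<open>c(t) = b(t)\<^sup>-\<^sup>1\<close> and \<open>p(t) = b(t) + i t y\<close>. The curve \<open>u p(t)\<close>
  consists of unitaries and \<open>p' = i y c p\<close>. It ends at \<open>uv\<close> because \<open>b(1) = Re v\<close>: both are roots of
  \<open>1 - y\<^sup>2\<close>, and the hypothesis makes \<open>Re v\<close> the positive one.
\<close>

lemma d_infty_le_arcsin:
  assumes u: "u \<in> unitary_group" and v: "v \<in> unitary_group"
    and pos: "\<And>x. 0 \<le> ip x (v * x)" and less: "norm (im_part v) < 1"
  shows "d_infty u (u * v) \<le> ereal (arcsin (norm (im_part v)))"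
proof -
  let ?h = "re_part v"
  define y where "y = im_part v"
  have sy: "star y = y" by (simp add: y_def)
  have ny: "norm y < 1" using less by (simp add: y_def)
  have nyy: "norm (y * y) < 1"
    using norm_mult_ineq[of y y] mult_strict_mono'[OF ny ny] by simp
  define b where "b t = one_minus_power (1/2) (t\<^sup>2 *\<^sub>R (y * y))" for t
  define c where "c t = one_minus_power (-1/2) (t\<^sup>2 *\<^sub>R (y * y))" for t
  have small: "norm (t\<^sup>2 *\<^sub>R (y * y)) \<le> (t * norm y)\<^sup>2" for t
    using mult_left_mono[OF norm_mult_ineq[of y y], of "t\<^sup>2"] by (simp add: power2_eq_square mult_ac)
  have ty: "\<bar>t * norm y\<bar> < 1" if "t \<in> {0..1}" for t
    using that ny mult_left_le_one_le[of "norm y" t] by auto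
  have small': "norm (t\<^sup>2 *\<^sub>R (y * y)) < 1" if "t \<in> {0..1}" for t
    using small[of t] ty[OF that] by (meson abs_square_less_1 order_le_less_trans)
  have sb: "star (b t) = b t" and bb: "b t * b t = 1 - (t *\<^sub>R y) * (t *\<^sub>R y)"
    and b_comm: "b t * y = y * b t" and cb: "c t * b t = 1"
    if "t \<in> {0..1}" for t
    unfolding b_def c_def
    using small'[OF that] star_one_minus_power_half[of "t\<^sup>2 *\<^sub>R (y * y)"]
      one_minus_power_half_squared[of "t\<^sup>2 *\<^sub>R (y * y)"]
      one_minus_power_commute[OF summable_one_minus_power_half, of "t\<^sup>2 *\<^sub>R (y * y)" y]
      one_minus_power_neg_half_mult_half[of "t\<^sup>2 *\<^sub>R (y * y)"]
    by (simp_all add: star_scaleR star_mult sy power2_eq_square mult.assoc)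
  have b1: "b 1 = ?h"
  proof -
    have n: "norm (1 - b 1) \<le> 1"
      unfolding b_def using small'[of 1] by (intro norm_one_minus_one_minus_power_half_le) simp
    \<comment> \<open>A self-adjoint root of \<open>b(1)\<close>, so that uniqueness of the positive root applies.\<close>
    define d where "d = one_minus_power (1/2) (1 - b 1)"
    have dd: "d * d = b 1"
      unfolding d_def one_minus_power_half_squared[OF n] by simp
    have "?h = d * d"
    proof (rule eq_square_if_squares_eq)
      show "star d = d"
        unfolding d_def by (rule star_one_minus_power_half[OF n]) (simp add: star_diff sb)
      have "y * ?h = ?h * y" using unitary_re_im_part(1)[OF v] by (simp add: y_def)
      then have "y * y * ?h = ?h * (y * y)" by (metis mult.assoc)
      then have "b 1 * ?h = ?h * b 1"
        unfolding b_def using small'[of 1]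
        by (intro one_minus_power_commute[OF summable_one_minus_power_half]) simp_all
      then show "d * ?h = ?h * d"
        unfolding d_def
        by (intro one_minus_power_commute[OF summable_one_minus_power_half[OF n]])
           (simp add: left_diff_distrib right_diff_distrib)
      show "(d * d) * (d * d) = ?h * ?h"
        using unitary_re_im_part(2)[OF v] bb[of 1]
        by (simp add: dd y_def eq_diff_eq) (metis add_right_cancel)
      show "0 \<le> ip x (?h * x)" for x using pos[of x] by (simp add: ip_re_part)
    qed simp
    then show ?thesis by (simp add: dd)
  qed
  define p where "p t = b t + \<i> *\<^sub>C (t *\<^sub>R y)" for t
  have p: "p t \<in> unitary_group" if "t \<in> {0..1}" for t
    unfolding p_def using that
    by (intro unitary_add_i_mult) (simp_all add: sb star_scaleR sy b_comm bb)
  have p0: "p 0 = 1" by (simp add: p_def b_def)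
  have p1: "p 1 = v"
    unfolding p_def b1 using re_part_add_im_part[of v] by (simp add: y_def)
  show ?thesis
  proof (cases "y = 0")
    case True
    then have "v = 1" using p1 p0 by (simp add: p_def b_def)
    then show ?thesis
      using d_infty_refl[OF u] by (simp add: im_part_def zero_ereal_def)
  next
    case False
    define \<gamma> where "\<gamma> t = u * p t" for t
    define D where "D t = \<i> *\<^sub>C (u * ((y * c t) * p t))" for t
    have der: "(\<gamma> has_vector_derivative D t) (at t within {0..1})" if t: "t \<in> {0..1}" for t
    proof -
      have "(b has_vector_derivative (- t) *\<^sub>R (y * y * c t)) (at t within {0..1})"
        unfolding b_def c_def by (rule has_vector_derivative_one_minus_power_half[OF nyy t])
      moreover have "((\<lambda>t. t *\<^sub>R y) has_vector_derivative y) (at t within {0..1})"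
        by (auto intro!: derivative_eq_intros)
      ultimately have "(p has_vector_derivative (- t) *\<^sub>R (y * y * c t) + \<i> *\<^sub>C y) (at t within {0..1})"
        unfolding p_def
        by (intro has_vector_derivative_add bounded_linear.has_vector_derivative[OF bounded_linear_scaleC])
      moreover have "(- t) *\<^sub>R (y * y * c t) + \<i> *\<^sub>C y = \<i> *\<^sub>C ((y * c t) * p t)"
      proof -
        have cy: "c t * y = y * c t"
          unfolding c_def using small'[OF t]
          by (intro one_minus_power_commute[OF summable_one_minus_power_neg_half]) (simp_all add: mult.assoc)
        have "(y * c t) * p t = y + \<i> *\<^sub>C (t *\<^sub>R (y * y * c t))"
          by (simp add: p_def distrib_left mult.assoc cb[OF t] mult_scaleC_right cy)
        then show ?thesis
          using scaleC_of_real[of "-1" "t *\<^sub>R (y * y * c t)"]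
          by (simp add: scaleC_add_right scaleC_scaleC)
      qed
      ultimately have "(p has_vector_derivative \<i> *\<^sub>C ((y * c t) * p t)) (at t within {0..1})"
        by simp
      from bounded_linear.has_vector_derivative[OF bounded_linear_mult_right this, of u]
      show ?thesis by (simp add: \<gamma>_def[abs_def] D_def mult_scaleC_right)
    qed
    have contc: "continuous_on {0..1} c"
      unfolding c_def by (rule continuous_on_one_minus_power_neg_half[OF nyy])
    have contp: "continuous_on {0..1} p"
    proof -
      have "continuous_on {0..1} b"
        unfolding b_def
        by (rule continuous_on_vector_derivative[OF has_vector_derivative_one_minus_power_half[OF nyy]])
      then show ?thesis
        unfolding p_def
        by (intro continuous_intros bounded_linear.continuous_on[OF bounded_linear_scaleC])
    qed
    have contD: "continuous_on {0..1} D"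
      unfolding D_def
      by (intro bounded_linear.continuous_on[OF bounded_linear_scaleC] continuous_intros contc contp)
    have D0: "D t \<noteq> 0" if t: "t \<in> {0..1}" for t
    proof
      assume "D t = 0"
      then have "norm (D t) = 0" by simp
      then have "u * ((y * c t) * p t) = 0" unfolding D_def norm_scaleC by simp
      then have "(y * c t) * p t = 0" using unitary_group_cancel(1)[OF u, of "(y * c t) * p t"] by simp
      then have "y * c t * (p t * star (p t)) = 0" by (simp flip: mult.assoc)
      then have "y * c t = 0" by (simp add: unitary_groupD[OF p[OF t]])
      then have "y * (c t * b t) = 0" by (simp flip: mult.assoc)
      then show False using False by (simp add: cb[OF t])
    qed
    have "smooth_curve_on 0 1 \<gamma>"
      unfolding smooth_curve_on_def using contD der D0 by blast
    then have "piecewise_smooth_curve_on 0 1 \<gamma>"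
      unfolding piecewise_smooth_curve_on_def by (intro conjI exI[of _ 1] exI[of _ real]) simp_all
    then have "d_infty (\<gamma> 0) (\<gamma> 1) \<le> ereal (curve_length 0 1 \<gamma>)"
      by (rule d_infty_le_curve_length) (simp add: \<gamma>_def unitary_group_mult u p)
    also have "curve_length 0 1 \<gamma> = integral {0..1} (\<lambda>t. norm (D t))"
      by (rule curve_length_smooth) (use der in auto)
    also have "\<dots> \<le> arcsin (1 * norm y) - arcsin (0 * norm y)"
    proof (rule has_integral_le)
      show "((\<lambda>t. norm (D t)) has_integral integral {0..1} (\<lambda>t. norm (D t))) {0..1}"
        by (intro integrable_integral integrable_continuous_real continuous_on_norm contD)
      show "((\<lambda>t. norm y / sqrt (1 - (t * norm y)\<^sup>2)) has_integral
              arcsin (1 * norm y) - arcsin (0 * norm y)) {0..1}"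
      proof (rule fundamental_theorem_of_calculus)
        show "((\<lambda>t. arcsin (t * norm y)) has_vector_derivative norm y / sqrt (1 - (t * norm y)\<^sup>2))
                (at t within {0..1})" if "t \<in> {0..1}" for t
          unfolding has_real_derivative_iff_has_vector_derivative[symmetric]
          using ty[OF that] by (auto intro!: derivative_eq_intros simp: abs_less_iff divide_simps)
      qed simp
      show "norm (D t) \<le> norm y / sqrt (1 - (t * norm y)\<^sup>2)" if t: "t \<in> {0..1}" for t
      proof -
        have "norm (D t) = norm (u * ((y * c t) * p t))" by (simp add: D_def norm_scaleC)
        also have "\<dots> \<le> norm u * (norm (y * c t) * norm (p t))"
          by (intro order_trans[OF norm_mult_ineq] mult_left_mono norm_mult_ineq norm_ge_zero)
        also have "\<dots> = norm (y * c t)" by (simp add: norm_unitary u p[OF t])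
        also have "\<dots> \<le> norm y * norm (c t)" by (rule norm_mult_ineq)
        also have "\<dots> \<le> norm y * (1 / sqrt (1 - (t * norm y)\<^sup>2))"
          unfolding c_def using ty[OF t]
          by (intro mult_left_mono norm_one_minus_power_neg_half_le small) (auto simp: abs_square_less_1)
        finally show ?thesis by simp
      qed
    qed
    finally show ?thesis by (simp add: \<gamma>_def p0 p1 y_def)
  qed
qed

text \<open>
  The two bounds meet. The lower one also supplies the positivity of \<open>Re v\<close> and \<open>\<parallel>Im v\<parallel> < 1\<close>,
  under which the upper one holds.
\<close>

lemma d_infty_eq_arcsin:
  fixes u w :: 'a
  assumes u: "u \<in> unitary_group" and w: "w \<in> unitary_group"
    and less: "d_infty u w < ereal (pi / 2)"
  shows "d_infty u w = ereal (arcsin (norm (im_part (star u * w))))"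
proof -
  let ?v = "star u * w"
  have v: "?v \<in> unitary_group" using u w by (intro unitary_group_mult unitary_group_star)
  obtain r where r: "d_infty u w = ereal r" "0 \<le> r" "r < pi / 2"
    and le: "\<And>x. cos r * ip x x \<le> ip x (?v * x)"
    using d_infty_lower_bound[OF u w less] by blast
  have nle: "norm (im_part ?v) \<le> sin r"
    by (rule norm_im_part_le_sin[OF v]) (use r le in auto)
  have "sin r < sin (pi / 2)" using r by (intro sin_monotone_2pi) auto
  then have n1: "norm (im_part ?v) < 1" using nle by simp
  have pos: "0 \<le> ip x (?v * x)" for x
  proof -
    have "0 \<le> cos r * ip x x" using r ip_self_nonneg by (intro mult_nonneg_nonneg cos_ge_zero) auto
    then show ?thesis using le[of x] by linarith
  qed
  have "d_infty u w \<le> ereal (arcsin (norm (im_part ?v)))"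
    using d_infty_le_arcsin[OF u v pos n1] by (simp add: unitary_group_cancel u)
  moreover have "arcsin (norm (im_part ?v)) \<le> arcsin (sin r)"
    using nle n1 by (intro arcsin_le_arcsin) (auto intro: order_trans[of _ 0])
  moreover have "arcsin (sin r) = r" using r by (intro arcsin_sin) auto
  ultimately show ?thesis using r by simp
qed

section \<open>Midpoint convexity\<close>

text \<open>
  Subtract from \<open>a\<close> and \<open>c\<close> their components along \<open>b\<close>; the remainders have lengths \<open>sin\<close> of the
  respective angles, and the Cauchy-Schwarz inequality turns the claim into the addition theorem for
  \<open>cos\<close>.
\<close>

lemma ip_spherical_triangle:
  assumes unit: "ip a a = 1" "ip b b = 1" "ip c c = 1"
    and ab: "cos \<alpha> \<le> ip a b" and bc: "cos \<beta> \<le> ip b c"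
    and angles: "0 \<le> \<alpha>" "0 \<le> \<beta>" "\<alpha> + \<beta> \<le> pi"
  shows "cos (\<alpha> + \<beta>) \<le> ip a c"
proof -
  let ?p = "ip a b" and ?q = "ip b c"
  let ?a = "a - ?p *\<^sub>R b" and ?c = "c - ?q *\<^sub>R b"
  have p: "\<bar>?p\<bar> \<le> 1" and q: "\<bar>?q\<bar> \<le> 1"
    using ip_Cauchy_Schwarz[of a b] ip_Cauchy_Schwarz[of b c] unit by (simp_all add: abs_square_le_1)
  have "arccos ?p \<le> \<alpha>" "arccos ?q \<le> \<beta>"
    using ab bc p q angles arccos_le_arccos[of "cos \<alpha>" ?p] arccos_le_arccos[of "cos \<beta>" ?q]
    by (auto simp: arccos_cos)
  then have "cos (\<alpha> + \<beta>) \<le> cos (arccos ?p + arccos ?q)"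
    using angles p q by (intro cos_monotone_0_pi_le add_nonneg_nonneg arccos_lbound add_mono) auto
  also have "\<dots> = ?p * ?q - sqrt (1 - ?p\<^sup>2) * sqrt (1 - ?q\<^sup>2)"
    using p q by (simp add: cos_add sin_arccos_abs)
  also have "\<dots> \<le> ?p * ?q + ip ?a ?c"
  proof -
    have "ip ?a ?a = 1 - ?p\<^sup>2" "ip ?c ?c = 1 - ?q\<^sup>2"
      by (simp_all add: ip_diff_left ip_diff_right ip_scaleR_left ip_scaleR_right unit
          ip_commute[of b a] ip_commute[of c b] power2_eq_square)
    then have "\<bar>ip ?a ?c\<bar> \<le> sqrt (1 - ?p\<^sup>2) * sqrt (1 - ?q\<^sup>2)"
      using ip_Cauchy_Schwarz[of ?a ?c] real_le_rsqrt[of "\<bar>ip ?a ?c\<bar>"]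
      by (simp flip: real_sqrt_mult)
    then show ?thesis by linarith
  qed
  also have "\<dots> = ip a c"
    by (simp add: ip_diff_left ip_diff_right ip_scaleR_left ip_scaleR_right unit)
  finally show ?thesis .
qed

text \<open>
  The largest angle of a product is at most the sum of the largest angles: apply the spherical triangle
  inequality to \<open>U\<^sup>*x\<close>, \<open>x\<close> and \<open>Vx\<close>.
\<close>

lemma cos_add_le_ip_mult:
  assumes U: "U \<in> unitary_group" and V: "V \<in> unitary_group"
    and leU: "\<And>x. cos \<alpha> * ip x x \<le> ip x (U * x)" and leV: "\<And>x. cos \<beta> * ip x x \<le> ip x (V * x)"
    and angles: "0 \<le> \<alpha>" "0 \<le> \<beta>" "\<alpha> + \<beta> \<le> pi"
  shows "cos (\<alpha> + \<beta>) * ip x x \<le> ip x (U * V * x)"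
proof (cases "x = 0")
  case False
  then have n: "ip x x > 0" using ip_self_eq_zero[of x] ip_self_nonneg[of x] by linarith
  define y where "y = (1 / sqrt (ip x x)) *\<^sub>R x"
  have N: "ip y y = 1" using n by (simp add: y_def ip_scaleR_left ip_scaleR_right)
  have "cos (\<alpha> + \<beta>) \<le> ip (star U * y) (V * y)"
  proof (rule ip_spherical_triangle[where b = y])
    show "ip (star U * y) (star U * y) = 1" "ip (V * y) (V * y) = 1" "ip y y = 1"
      by (simp_all add: ip_unitary unitary_group_star U V N)
    show "cos \<alpha> \<le> ip (star U * y) y" using leU[of y] by (simp add: N ip_mult_left star_star)
    show "cos \<beta> \<le> ip y (V * y)" using leV[of y] by (simp add: N)
  qed (use angles in auto)
  also have "\<dots> = ip y (U * V * y)" by (simp add: ip_mult_left star_star mult.assoc)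
  also have "\<dots> = ip x (U * V * x) / ip x x"
    using n by (simp add: y_def ip_scaleR_left ip_scaleR_right)
  finally show ?thesis using n by (simp add: le_divide_eq)
qed simp

text \<open>
  The heart of the argument: \<open>v\<^sup>2\<close> is the product of \<open>vW\<^sup>*\<close> and the conjugate \<open>W(vW)W\<^sup>*\<close> of \<open>vW\<close>. So
  \<open>v\<^sup>2\<close> turns no vector by more than \<open>\<alpha> + \<beta>\<close>, whence \<open>\<parallel>Im v\<parallel> \<le> sin ((\<alpha> + \<beta>)/2)\<close>.
\<close>

lemma arcsin_midpoint_le:
  assumes v: "v \<in> unitary_group" and W: "W \<in> unitary_group"
    and \<alpha>: "0 \<le> \<alpha>" "\<alpha> \<le> pi / 2" "\<And>x. cos \<alpha> * ip x x \<le> ip x (v * star W * x)"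
    and \<beta>: "0 \<le> \<beta>" "\<beta> \<le> pi / 2" "\<And>x. cos \<beta> * ip x x \<le> ip x (v * W * x)"
  shows "arcsin (norm (im_part v)) \<le> (\<alpha> + \<beta>) / 2"
proof -
  let ?U = "v * star W" and ?V = "W * (v * W) * star W"
  have vv: "v * v = ?U * ?V"
    by (simp add: mult.assoc unitary_group_cancel unitary_groupD W)
  have U: "?U \<in> unitary_group" and V: "?V \<in> unitary_group"
    using v W by (auto intro!: unitary_group_mult unitary_group_star)
  have leV: "cos \<beta> * ip x x \<le> ip x (?V * x)" for x
    using \<beta>(3)[of "star W * x"] ip_unitary[OF unitary_group_star[OF W], of x x]
    by (simp add: ip_mult_left[of "star W" x] star_star mult.assoc)
  have "norm (im_part v) \<le> sin ((\<alpha> + \<beta>) / 2)"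
  proof (rule norm_im_part_le_sin_if_square[OF v])
    show "cos (2 * ((\<alpha> + \<beta>) / 2)) * ip x x \<le> ip x (v * v * x)" for x
    proof -
      have "2 * ((\<alpha> + \<beta>) / 2) = \<alpha> + \<beta>" by simp
      then show ?thesis
        using cos_add_le_ip_mult[OF U V \<alpha>(3) leV, of x] \<alpha>(1,2) \<beta>(1,2) by (simp only: vv)
    qed
  qed (use \<alpha> \<beta> in auto)
  then have "arcsin (norm (im_part v)) \<le> arcsin (sin ((\<alpha> + \<beta>) / 2))"
    by (intro arcsin_le_arcsin) (auto intro: order_trans[of _ 0])
  also have "\<dots> = (\<alpha> + \<beta>) / 2" using \<alpha> \<beta> by (intro arcsin_sin) auto
  finally show ?thesis .
qed

end

text \<open>
  Subtract the chord. If the difference had a positive maximum, consider the leftmost point where it is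
  attained: it is interior, and by midpoint convexity any two points placed symmetrically about it attain the
  maximum too, one of them further left.
\<close>

lemma convex_on_if_midpoint_convex:
  fixes f :: "real \<Rightarrow> real"
  assumes cont: "continuous_on {a..b} f"
    and mid: "\<And>s t. s \<in> {a..b} \<Longrightarrow> t \<in> {a..b} \<Longrightarrow> f ((s + t) / 2) \<le> (f s + f t) / 2"
  shows "convex_on {a..b} f"
proof (rule convex_onI)
  fix t x y assume t: "0 < t" "t < (1::real)" and x: "x \<in> {a..b}" and y: "y \<in> {a..b}"
  define g where "g s = f ((1 - s) * x + s * y) - ((1 - s) * f x + s * f y)" for s
  have in_ab: "(1 - s) * x + s * y \<in> {a..b}" if "s \<in> {0..1}" for s
    using convexD_alt[OF convex_real_interval(5)[of a b] x y, of s] that by simp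
  have g01: "g 0 = 0" "g 1 = 0" by (simp_all add: g_def)
  have contg: "continuous_on {0..1} g"
    unfolding g_def
    by (intro continuous_intros continuous_on_compose2[OF cont]) (use in_ab in auto)
  have midg: "g ((r + s) / 2) \<le> (g r + g s) / 2" if "r \<in> {0..1}" "s \<in> {0..1}" for r s
  proof -
    have "(1 - (r + s) / 2) * x + (r + s) / 2 * y = (((1 - r) * x + r * y) + ((1 - s) * x + s * y)) / 2"
      by (simp add: field_simps)
    then have "f ((1 - (r + s) / 2) * x + (r + s) / 2 * y)
        \<le> (f ((1 - r) * x + r * y) + f ((1 - s) * x + s * y)) / 2"
      using mid[OF in_ab[OF that(1)] in_ab[OF that(2)]] by (simp only:)
    moreover have "(1 - (r + s) / 2) * f x + (r + s) / 2 * f y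
        = (((1 - r) * f x + r * f y) + ((1 - s) * f x + s * f y)) / 2"
      by (simp add: field_simps)
    ultimately show ?thesis by (simp add: g_def)
  qed
  have "g t \<le> 0"
  proof (rule ccontr)
    assume "\<not> g t \<le> 0"
    obtain m where m: "m \<in> {0..1}" "\<And>s. s \<in> {0..1} \<Longrightarrow> g s \<le> g m"
      using continuous_attains_sup[of "{0..1::real}" g] contg by auto
    have gm: "g m > 0" using m(2)[of t] t \<open>\<not> g t \<le> 0\<close> by simp
    let ?Z = "{s \<in> {0..1}. g s = g m}"
    have "compact ?Z"
      using continuous_closed_preimage_constant[OF contg, of "g m"]
      by (auto simp: compact_eq_bounded_closed intro: bounded_subset[of "{0..1}"])
    moreover have "?Z \<noteq> {}" using m by auto
    ultimately obtain s where s: "s \<in> ?Z" "\<And>r. r \<in> ?Z \<Longrightarrow> s \<le> r"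
      using compact_attains_inf[of ?Z] by blast
    have s01: "0 < s" "s < 1" using s(1) g01 gm by (auto simp: less_le)
    define d where "d = min s (1 - s)"
    have d: "0 < d" "s - d \<in> {0..1}" "s + d \<in> {0..1}" using s01 by (auto simp: d_def)
    have "g s \<le> (g (s - d) + g (s + d)) / 2" using midg[OF d(2,3)] by simp
    then have "g (s - d) = g m" using m(2)[OF d(2)] m(2)[OF d(3)] s(1) by simp
    then show False using s(2)[of "s - d"] d by simp
  qed
  then show "f ((1 - t) *\<^sub>R x + t *\<^sub>R y) \<le> (1 - t) * f x + t * f y"
    by (simp add: g_def)
qed simp

section \<open>Convexity of the distance along a geodesic\<close>

theorem corollary3p4:
  fixes \<tau> :: "'a::unital_cstar_algebra \<Rightarrow> complex"
    and u :: 'a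
    and \<beta> :: "real \<Rightarrow> 'a"
  assumes "faithful_finite_trace \<tau>"
    and "u \<in> unitary_group"
    and "geodesic_on {0..1} \<beta>"
    and "\<And>s. s \<in> {0..1} \<Longrightarrow> d_infty u (\<beta> s) < ereal (pi / 2)"
  shows "convex_on {0..1} (\<lambda>s. real_of_ereal (d_infty u (\<beta> s)))"
proof -
  interpret faithful_positive_functional \<tau>
    using assms(1) by unfold_locales (auto simp: faithful_finite_trace_def)
  note u = assms(2)
  obtain w z where w: "w \<in> unitary_group" and z: "star z = - z"
    and \<beta>: "\<And>s. s \<in> {0..1} \<Longrightarrow> \<beta> s = w * exp (s *\<^sub>R z)"
    using assms(3) unfolding geodesic_on_def by blast
  have E: "exp (s *\<^sub>R z) \<in> unitary_group" for s
    by (rule exp_unitary) (simp add: star_scaleR z)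
  have B: "\<beta> s \<in> unitary_group" if "s \<in> {0..1}" for s
    using \<beta>[OF that] w E by (simp add: unitary_group_mult)
  define f where "f s = arcsin (norm (im_part (star u * \<beta> s)))" for s
  have d: "d_infty u (\<beta> s) = ereal (f s)" if "s \<in> {0..1}" for s
    unfolding f_def by (rule d_infty_eq_arcsin[OF u B[OF that] assms(4)[OF that]])
  have cos_le: "0 \<le> f s" "f s \<le> pi / 2" "cos (f s) * ip x x \<le> ip x (star u * \<beta> s * x)"
    if s: "s \<in> {0..1}" for s x
    using d_infty_lower_bound[OF u B[OF s] assms(4)[OF s]] d[OF s] by (metis ereal.inject less_imp_le)+
  have contf: "continuous_on {0..1} f"
  proof -
    have "norm (im_part (star u * \<beta> s)) \<le> 1" if "s \<in> {0..1}" for s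
      using norm_im_part_le[of "star u * \<beta> s"]
      by (simp add: norm_unitary unitary_group_mult unitary_group_star u B[OF that])
    moreover have "continuous_on {0..1} \<beta>"
    proof (rule continuous_on_eq[where f = "\<lambda>s. w * exp (s *\<^sub>R z)"])
      show "continuous_on {0..1} (\<lambda>s. w * exp (s *\<^sub>R z))"
        by (intro continuous_on_mult_left continuous_on_vector_derivative[OF exp_scaleR_has_vector_derivative_right])
    qed (simp add: \<beta>)
    ultimately show ?thesis
      unfolding f_def im_part_def
      by (intro continuous_intros bounded_linear.continuous_on[OF bounded_linear_scaleC]
          bounded_linear.continuous_on[OF bounded_linear_star])
         (auto intro: order_trans[OF _ norm_ge_zero])
  qed
  have midf: "f ((s + t) / 2) \<le> (f s + f t) / 2" if s: "s \<in> {0..1}" and t: "t \<in> {0..1}" for s t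
  proof -
    let ?m = "(s + t) / 2"
    let ?W = "exp (((t - s) / 2) *\<^sub>R z)"
    have m: "?m \<in> {0..1}" using s t by auto
    have add: "exp (p *\<^sub>R z) * exp (q *\<^sub>R z) = exp ((p + q) *\<^sub>R z)" for p q
      by (simp add: scaleR_add_left exp_add_commuting)
    have "star ?W = exp (((s - t) / 2) *\<^sub>R z)"
      by (simp add: star_exp star_scaleR z flip: scaleR_minus_left) (simp add: minus_divide_left)
    then have "star u * \<beta> ?m * star ?W = star u * \<beta> s" "star u * \<beta> ?m * ?W = star u * \<beta> t"
      by (simp_all add: \<beta>[OF m] \<beta>[OF s] \<beta>[OF t] mult.assoc add) (simp_all add: field_simps)
    moreover have "star u * \<beta> ?m \<in> unitary_group"
      using u B[OF m] by (intro unitary_group_mult unitary_group_star)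
    ultimately show "f ?m \<le> (f s + f t) / 2"
      unfolding f_def[of ?m]
      using arcsin_midpoint_le[of "star u * \<beta> ?m" ?W "f s" "f t", OF _ E] cos_le[OF s] cos_le[OF t]
      by simp
  qed
  show ?thesis
  proof (rule convex_on_if_midpoint_convex)
    show "continuous_on {0..1} (\<lambda>s. real_of_ereal (d_infty u (\<beta> s)))"
      by (rule continuous_on_eq[OF contf]) (simp add: d)
    show "real_of_ereal (d_infty u (\<beta> ((s + t) / 2)))
        \<le> (real_of_ereal (d_infty u (\<beta> s)) + real_of_ereal (d_infty u (\<beta> t))) / 2"
      if "s \<in> {0..1}" "t \<in> {0..1}" for s t
    proof -
      have "(s + t) / 2 \<in> {0..1}" using that by auto
      then show ?thesis using midf[OF that] by (simp add: d that del: atLeastAtMost_iff)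
    qed
  qed
qed

end
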